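(* Let $n\ge1$, let $\Gamma^\circ$ be a totally ordered abelian group and let $L^\circ:W_n\to\Gamma^\circ$ be a weight function on the Weyl group $W_n$ of type $B_n$ such that $L^\circ(s)>0$ for every $s\in S_n=\{t,s_1,\dots,s_{n-1}\}$. Let $b=L^\circ(t)$ and $a=L^\circ(s_1)=\dots=L^\circ(s_{n-1})$. Let $\theta_{\mathcal{H}}:\mathcal{H}_n\to\mathcal{H}_n^\circ$ be the specialization morphism from the Hecke algebra with asymptotic parameters to the Hecke algebra associated with $L^\circ$. If $b\le(n-1)a$, then there exists $w\in W_n$ such that $\theta_{\mathcal{H}}(C_w)\neq C_w^\circ$.
   Context: $W_n$ is the Coxeter group with generators $S_n=\{t,s_1,\dots,s_{n-1}\}$, where $t^2=s_i^2=1$, $(ts_1)^4=1$, $(s_is_{i+1})^3=1$, and all other pairs of generators commute. $\ell$ is the length function. If $n=1$, $a$ denotes any positive element of $\Gamma^\circ$ (and then the hypothesis $b\le (n-1)a$ is never satisfied). General Hecke algebra: for a totally ordered abelian group $\Gamma$ and a weight function $L:W_n\to\Gamma$ (i.e. $L(ww')=L(w)+L(w')$ whenever $\ell(ww')=\ell(w)+\ell(w')$) positive on $S_n$, let $\mathbb{Z}[\Gamma]$ be the group ring written exponentially with basis $(v^\gamma)_{\gamma\in\Gamma}$, with bar automorphism $v^\gamma\mapsto v^{-\gamma}$, and let $\mathbb{Z}[\Gamma]_{<0}=\bigoplus_{\gamma<0}\mathbb{Z}v^\gamma$. The Hecke algebra $\mathcal{H}(W_n,S_n,L)$ has $\mathbb{Z}[\Gamma]$-basis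 $(T_w)_{w\in W_n}$ with $T_wT_{w'}=T_{ww'}$ if $\ell(ww')=\ell(w)+\ell(w')$ and $T_s^2=1+(v^{L(s)}-v^{-L(s)})T_s$ for $s\in S_n$. Bar involution: $\overline{\sum_wa_wT_w}=\sum_w\bar a_wT_{w^{-1}}^{-1}$. The Kazhdan-Lusztig basis $(C_w)$ is characterized by $\overline{C_w}=C_w$ and $C_w\in T_w+\bigoplus_{y}\mathbb{Z}[\Gamma]_{<0}T_y$. Asymptotic case: $\Gamma=\mathbb{Z}^2$ with the lexicographic order ($(a,b)\le(a',b')$ iff $a<a'$ or ($a=a'$ and $b\le b'$)), $L_n(w)=(\ell_t(w),\ell(w)-\ell_t(w))$, where $\ell_t(w)$ is the number of occurrences of $t$ in a reduced expression of $w$. Then $A=\mathbb{Z}[\Gamma]=\mathbb{Z}[V^{\pm1},v^{\pm1}]$ with $V=v^{(1,0)}$, $v=v^{(0,1)}$; $\mathcal{H}_n=\mathcal{H}(W_n,S_n,L_n)$ with bases $(T_w)$ and $(C_w)$. Specialized case: $A^\circ=\mathbb{Z}[\Gamma^\circ]$, $\mathcal{H}_n^\circ=\mathcal{H}(W_n,S_n,L^\circ)$, with standard basis $(T_w^\circ)$ and Kazhdan-Lusztig basis $(C_w^\circ)$. Let $\theta_A:A\to A^\circ$ be the ring morphism with $\theta_A(V)=v^b$, $\theta_A(v)=v^a$. Viewing $\mathcal{H}_n^\circ$ as an $A$-algebra through $\theta_A$, $\theta_{\mathcal{H}}:\mathcal{H}_n\to\mathcal{H}_n^\circ$ is the unique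 morphism of $A$-algebras with $\theta_{\mathcal{H}}(T_w)=T_w^\circ$ for all $w\in W_n$. *)

theory Defs
  imports
    "HOL-Algebra.Group"
    "HOL-Library.Poly_Mapping"
    "HOL-Library.Product_Plus"
    "HOL-Library.Product_Lexorder"
begin

section \<open>The Coxeter group of type \<open>B\<^sub>n\<close>\<close>

text \<open>
  The letter \<open>0\<close> stands for \<open>t\<close> and the letter \<open>i\<close>, for \<open>1 \<le> i < n\<close>, for \<open>s\<^sub>i\<close>.
  \<open>cox_B i j\<close> is the order of the product of the generators \<open>i\<close> and \<open>j\<close> in the presentation.
\<close>

definition cox_B :: "nat \<Rightarrow> nat \<Rightarrow> nat" where
  "cox_B i j =
     (if i = j then 1
      else if {i, j} = {0, 1} then 4
      else if j = Suc i \<or> i = Suc j then 3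
      else 2)"

text \<open>
  The group presentation is rendered as a monoid presentation. The relations \<open>(i i)\<^sup>1 = 1\<close>
  make every generator an involution, so no letters for inverses are needed.
\<close>

inductive_set cox_rel :: "nat \<Rightarrow> (nat list \<times> nat list) set" for n :: nat where
  refl: "u \<in> lists {..<n} \<Longrightarrow> (u, u) \<in> cox_rel n"
| sym: "(u, v) \<in> cox_rel n \<Longrightarrow> (v, u) \<in> cox_rel n"
| trans: "(u, v) \<in> cox_rel n \<Longrightarrow> (v, w) \<in> cox_rel n \<Longrightarrow> (u, w) \<in> cox_rel n"
| rel: "u \<in> lists {..<n} \<Longrightarrow> v \<in> lists {..<n} \<Longrightarrow> i < n \<Longrightarrow> j < n \<Longrightarrow>
    (u @ concat (replicate (cox_B i j) [i, j]) @ v, u @ v) \<in> cox_rel n"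

definition W :: "nat \<Rightarrow> nat list set monoid" where
  "W n =
     \<lparr> carrier = lists {..<n} // cox_rel n,
       monoid.mult = (\<lambda>x y. cox_rel n `` {u @ v | u v. u \<in> x \<and> v \<in> y}),
       one = cox_rel n `` {[]} \<rparr>"

definition gen :: "nat \<Rightarrow> nat \<Rightarrow> nat list set" where
  "gen n i = cox_rel n `` {[i]}"

definition gens :: "nat \<Rightarrow> nat list set set" where
  "gens n = gen n ` {..<n}"

text \<open>An element of \<^term>\<open>W n\<close> is the set of all its expressions as a word in the generators.\<close>

definition len :: "nat list set \<Rightarrow> nat" where
  "len w = (LEAST k. \<exists>u\<in>w. length u = k)"

definition len_t :: "nat list set \<Rightarrow> nat" where
  "len_t w = count_list (SOME u. u \<in> w \<and> length u = len w) 0"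

definition weight_function :: "nat \<Rightarrow> (nat list set \<Rightarrow> 'g::linordered_ab_group_add) \<Rightarrow> bool" where
  "weight_function n L \<longleftrightarrow>
     (\<forall>x\<in>carrier (W n). \<forall>y\<in>carrier (W n).
        len (x \<otimes>\<^bsub>W n\<^esub> y) = len x + len y \<longrightarrow> L (x \<otimes>\<^bsub>W n\<^esub> y) = L x + L y)"


section \<open>Group rings\<close>

type_synonym 'g group_ring = "'g \<Rightarrow>\<^sub>0 int"

definition vpow :: "'g \<Rightarrow> 'g group_ring" where
  "vpow g = Poly_Mapping.single g 1"

definition ring_bar :: "'g::ab_group_add group_ring \<Rightarrow> 'g group_ring" where
  "ring_bar = frag_extend (\<lambda>g. vpow (- g))"

definition ring_neg :: "'g::linordered_ab_group_add group_ring set" where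
  "ring_neg = {p. \<forall>g\<in>Poly_Mapping.keys p. g < 0}"


section \<open>Hecke algebras\<close>

text \<open>
  Elements of the Hecke algebra are coordinate vectors with respect to the basis \<open>(T\<^sub>w)\<close>.
  Only the multiplication has to be specified further. The defining relations determine it
  uniquely on \<open>hecke_carrier n\<close>.
\<close>

type_synonym 'g hecke = "nat list set \<Rightarrow>\<^sub>0 'g group_ring"

definition hecke_carrier :: "nat \<Rightarrow> 'g hecke set" where
  "hecke_carrier n = {x. Poly_Mapping.keys x \<subseteq> carrier (W n)}"

definition T :: "nat list set \<Rightarrow> 'g::ab_group_add hecke" where
  "T w = Poly_Mapping.single w 1"

definition smul :: "'g::ab_group_add group_ring \<Rightarrow> 'g hecke \<Rightarrow> 'g hecke" where
  "smul p x = Poly_Mapping.map ((*) p) x"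

definition hecke_algebra ::
    "nat \<Rightarrow> (nat list set \<Rightarrow> 'g::linordered_ab_group_add) \<Rightarrow>
     ('g hecke \<Rightarrow> 'g hecke \<Rightarrow> 'g hecke) \<Rightarrow> bool" where
  "hecke_algebra n L m \<longleftrightarrow>
     (\<forall>x\<in>hecke_carrier n. \<forall>y\<in>hecke_carrier n. m x y \<in> hecke_carrier n) \<and>
     (\<forall>x\<in>hecke_carrier n. \<forall>y\<in>hecke_carrier n. \<forall>z\<in>hecke_carrier n.
        m (m x y) z = m x (m y z) \<and>
        m (x + y) z = m x z + m y z \<and>
        m x (y + z) = m x y + m x z) \<and>
     (\<forall>p. \<forall>x\<in>hecke_carrier n. \<forall>y\<in>hecke_carrier n.
        m (smul p x) y = smul p (m x y) \<and> m x (smul p y) = smul p (m x y)) \<and>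
     (\<forall>x\<in>hecke_carrier n. m (T \<one>\<^bsub>W n\<^esub>) x = x \<and> m x (T \<one>\<^bsub>W n\<^esub>) = x) \<and>
     (\<forall>w\<in>carrier (W n). \<forall>w'\<in>carrier (W n).
        len (w \<otimes>\<^bsub>W n\<^esub> w') = len w + len w' \<longrightarrow> m (T w) (T w') = T (w \<otimes>\<^bsub>W n\<^esub> w')) \<and>
     (\<forall>s\<in>gens n. m (T s) (T s) = T \<one>\<^bsub>W n\<^esub> + smul (vpow (L s) - vpow (- L s)) (T s))"

definition hecke_inv ::
    "nat \<Rightarrow> ('g::ab_group_add hecke \<Rightarrow> 'g hecke \<Rightarrow> 'g hecke) \<Rightarrow> 'g hecke \<Rightarrow> 'g hecke" where
  "hecke_inv n m x =
     (THE y. y \<in> hecke_carrier n \<and> m x y = T \<one>\<^bsub>W n\<^esub> \<and> m y x = T \<one>\<^bsub>W n\<^esub>)"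

definition hecke_bar ::
    "nat \<Rightarrow> ('g::ab_group_add hecke \<Rightarrow> 'g hecke \<Rightarrow> 'g hecke) \<Rightarrow> 'g hecke \<Rightarrow> 'g hecke" where
  "hecke_bar n m x =
     (\<Sum>w\<in>Poly_Mapping.keys x.
        smul (ring_bar (Poly_Mapping.lookup x w)) (hecke_inv n m (T (inv\<^bsub>W n\<^esub> w))))"

definition kl_basis ::
    "nat \<Rightarrow> ('g::linordered_ab_group_add hecke \<Rightarrow> 'g hecke \<Rightarrow> 'g hecke) \<Rightarrow>
     (nat list set \<Rightarrow> 'g hecke) \<Rightarrow> bool" where
  "kl_basis n m C \<longleftrightarrow>
     (\<forall>w\<in>carrier (W n).
        C w \<in> hecke_carrier n \<and>
        hecke_bar n m (C w) = C w \<and>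
        (\<forall>y. Poly_Mapping.lookup (C w - T w) y \<in> ring_neg))"


section \<open>Asymptotic parameters and specialization\<close>

instance prod :: (linordered_ab_group_add, linordered_ab_group_add) linordered_ab_group_add
  by standard (auto simp: less_eq_prod_def)

definition L_asym :: "nat list set \<Rightarrow> int \<times> int" where
  "L_asym w = (int (len_t w), int (len w) - int (len_t w))"

definition zmult :: "int \<Rightarrow> 'g::ab_group_add \<Rightarrow> 'g" where
  "zmult k g = (if 0 \<le> k then (\<Sum>i<nat k. g) else - (\<Sum>i<nat (- k). g))"

text \<open>
  The monomial with exponent \<open>(i, j)\<close> is \<open>V\<^sup>i v\<^sup>j\<close>, hence its image is forced to be
  \<open>v\<^bsup>ib + ja\<^esup>\<close>. The lemmas below confirm that \<open>theta_A a b\<close> is a ring morphism with the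
  prescribed values on \<open>V\<close> and \<open>v\<close>.
\<close>

definition theta_A :: "'g::ab_group_add \<Rightarrow> 'g \<Rightarrow> (int \<times> int) group_ring \<Rightarrow> 'g group_ring" where
  "theta_A a b = frag_extend (\<lambda>(i, j). vpow (zmult i b + zmult j a))"

lemma zmult_0 [simp]: "zmult 0 g = 0"
  by (simp add: zmult_def)

lemma zmult_1 [simp]: "zmult 1 g = g"
  by (simp add: zmult_def)

lemma zmult_Suc: "zmult (k + 1) g = zmult k g + g"
proof (cases "0 \<le> k")
  case True
  then have "nat (k + 1) = Suc (nat k)" by simp
  with True show ?thesis by (simp add: zmult_def)
next
  case False
  then have "nat (- k) = Suc (nat (- (k + 1)))" by simp
  with False show ?thesis by (auto simp: zmult_def)
qed

lemma zmult_add: "zmult (k + l) g = zmult k g + zmult l g"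
proof (induction l rule: int_induct [where k = 0])
  case (step1 i)
  then show ?case using zmult_Suc [of "k + i" g] zmult_Suc [of i g] by (simp add: algebra_simps)
next
  case (step2 i)
  then show ?case using zmult_Suc [of "k + i - 1" g] zmult_Suc [of "i - 1" g]
    by (simp add: algebra_simps)
qed simp

lemma theta_A_vpow: "theta_A a b (vpow (i, j)) = vpow (zmult i b + zmult j a)"
  by (simp add: theta_A_def vpow_def)

lemma theta_A_V: "theta_A a b (vpow (1, 0)) = vpow b"
  and theta_A_v: "theta_A a b (vpow (0, 1)) = vpow a"
  by (simp_all add: theta_A_vpow)

lemma theta_A_0 [simp]: "theta_A a b 0 = 0"
  by (simp add: theta_A_def)

lemma theta_A_1: "theta_A a b 1 = 1"
  using theta_A_vpow [of a b 0 0] by (simp add: vpow_def zero_prod_def [symmetric])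

lemma theta_A_add: "theta_A a b (x + y) = theta_A a b x + theta_A a b y"
  by (simp add: theta_A_def frag_extend_add)

lemma theta_A_diff: "theta_A a b (x - y) = theta_A a b x - theta_A a b y"
  by (simp add: theta_A_def frag_extend_diff)

lemma theta_A_mult: "theta_A a b (x * y) = theta_A a b x * theta_A a b y"
proof -
  have vv: "vpow (g + h) = vpow g * vpow h" for g h :: "'c::ab_group_add"
    by (simp add: vpow_def mult_single)
  have base: "theta_A a b (vpow g * vpow h) = theta_A a b (vpow g) * theta_A a b (vpow h)"
    for g h :: "int \<times> int"
    by (cases g; cases h)
      (simp add: vv [symmetric] theta_A_vpow zmult_add algebra_simps)
  have right: "theta_A a b (vpow g * y) = theta_A a b (vpow g) * theta_A a b y"
    for g and y :: "(int \<times> int) group_ring"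
    using subset_UNIV [of "Poly_Mapping.keys y"]
  proof (induction y rule: frag_induction)
    case (one h)
    show ?case using base [of g h] by (simp add: vpow_def)
  qed (simp_all add: right_diff_distrib theta_A_diff)
  show ?thesis
    using subset_UNIV [of "Poly_Mapping.keys x"]
  proof (induction x rule: frag_induction)
    case (one g)
    show ?case using right [of g y] by (simp add: vpow_def)
  qed (simp_all add: left_diff_distrib theta_A_diff)
qed

text \<open>
  A morphism of \<open>A\<close>-algebras is \<open>\<theta>\<^sub>A\<close>-semilinear in these coordinates, so the condition
  \<open>T\<^sub>w \<mapsto> T\<^sub>w\<close> determines it.
\<close>

definition theta_H :: "'g::ab_group_add \<Rightarrow> 'g \<Rightarrow> (int \<times> int) hecke \<Rightarrow> 'g hecke" where
  "theta_H a b x = Poly_Mapping.map (theta_A a b) x"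

lemma theta_H_T: "theta_H a b (T w) = T w"
  by (simp add: theta_H_def T_def theta_A_1)

end

theory Submission
  imports Defs
begin

text \<open>
  The two bases are told apart by one coefficient. Let \<open>u\<close> be the longest element of the subgroup
  generated by \<open>s\<^sub>1, \<dots>, s\<^bsub>n-1\<^esub>\<close> and let \<open>z = s\<^bsub>n-1\<^esub> \<dots> s\<^sub>1 t u\<close>. With asymptotic parameters the
  coefficient of \<open>T\<^sub>u\<close> in \<open>C\<^sub>z\<close> is the twisted quantum integer
  \<open>V\<^bsup>-1\<^esup> (v\<^bsup>n-1\<^esup> + v\<^bsup>n-3\<^esup> + \<dots> + v\<^bsup>1-n\<^esup>)\<close>. All its terms have coefficient \<open>1\<close>, so nothing cancels
  under specialization, and the first term becomes \<open>v\<^bsup>(n-1)a-b\<^esup>\<close>. If \<open>b \<le> (n-1)a\<close>, this exponent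
  is not negative, whereas the coefficient of \<open>T\<^sub>u\<close> in the Kazhdan-Lusztig element of \<open>z\<close> for
  \<open>L\<^sup>\<circ>\<close> has only negative exponents, because \<open>u \<noteq> z\<close>.

  The element \<open>C\<^sub>z\<close> is found by writing down a candidate: an element that is fixed by the bar
  involution and congruent to \<open>T\<^sub>z\<close> modulo negative exponents must be \<open>C\<^sub>z\<close>
  (\<open>kl_basis_unique\<close>, a consequence of the unitriangularity of the bar involution).

  Candidates come from chains \<open>X\<^sub>0\<close>, \<open>X\<^bsub>j+1\<^esub> = T\<^bsub>\<sigma>(j)\<^esub> X\<^sub>j\<close> of elements of the Hecke algebra. If
  \<open>T\<^bsub>\<sigma>(j)\<^esub> X\<^sub>i = v X\<^sub>i\<close> for all \<open>i < j\<close>, then \<open>S\<^sub>j = \<Sum>\<^bsub>i\<le>j\<^esub> v\<^bsup>-(j-i)\<^esup> X\<^sub>i\<close> satisfies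
  \<open>(T\<^bsub>\<sigma>(j)\<^esub> + v\<^bsup>-1\<^esup>) S\<^sub>j = S\<^bsub>j+1\<^esub> + S\<^bsub>j-1\<^esub>\<close> (\<open>wsum_three_term\<close>). As \<open>T\<^sub>s + v\<^bsup>-1\<^esup>\<close> commutes with
  the bar involution, invariance passes along the chain. This is used twice.

    \<^item> The chain \<open>X\<^sub>j = T\<^bsub>k+2-j\<^esub> \<dots> T\<^bsub>k+1\<^esub> C\<close> turns the Kazhdan-Lusztig element \<open>C\<close> of the longest
      element of \<open>\<langle>s\<^sub>1, \<dots>, s\<^sub>k\<rangle>\<close> into that of \<open>\<langle>s\<^sub>1, \<dots>, s\<^bsub>k+1\<^esub>\<rangle>\<close>.

    \<^item> The chain \<open>X\<^sub>j = T\<^sub>j \<dots> T\<^sub>1 T\<^sub>t C\<close>, for \<open>C\<close> the element of \<open>\<langle>s\<^sub>1, \<dots>, s\<^bsub>n-1\<^esub>\<rangle>\<close>, starts from an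
      \<open>X\<^sub>0\<close> that is not invariant; \<open>X\<^sub>0 + V\<^bsup>-1\<^esup> C\<close> is. Hence one adds \<open>q\<^sub>j C\<close> to \<open>S\<^sub>j\<close>, where \<open>q\<^sub>j\<close>
      satisfies the same three-term recurrence with \<open>q\<^sub>0 = V\<^bsup>-1\<^esup>\<close>. Its solution is the twisted
      quantum integer above.

  To read off coefficients one needs to know that the words that occur are reduced. The group acts
  by signed permutations, a generator creates at most one new inversion, so a word with as many
  inversions as letters is reduced (\<open>reducedI\<close>).
\<close>

section \<open>Words and elements of the Coxeter group\<close>

definition cls :: "nat \<Rightarrow> nat list \<Rightarrow> nat list set" where
  "cls n u = cox_rel n `` {u}"

definition reduced :: "nat \<Rightarrow> nat list \<Rightarrow> bool" where
  "reduced n u \<longleftrightarrow> u \<in> lists {..<n} \<and> len (cls n u) = length u"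

lemma cox_rel_lists: "(u, v) \<in> cox_rel n \<Longrightarrow> u \<in> lists {..<n} \<and> v \<in> lists {..<n}"
proof (induction rule: cox_rel.induct)
  case (rel u v i j)
  then show ?case by (auto simp: in_lists_conv_set)
qed auto

lemma equiv_cox_rel: "equiv (lists {..<n}) (cox_rel n)"
proof (rule equivI)
  show "cox_rel n \<subseteq> lists {..<n} \<times> lists {..<n}" using cox_rel_lists by fastforce
  show "refl_on (lists {..<n}) (cox_rel n)" by (auto simp: refl_on_def intro: cox_rel.refl)
  show "sym (cox_rel n)" by (auto simp: sym_def intro: cox_rel.sym)
  show "trans (cox_rel n)" by (auto simp: trans_def intro: cox_rel.trans)
qed

lemma cls_eq_iff:
  "u \<in> lists {..<n} \<Longrightarrow> v \<in> lists {..<n} \<Longrightarrow> cls n u = cls n v \<longleftrightarrow> (u, v) \<in> cox_rel n"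
  unfolding cls_def by (rule eq_equiv_class_iff [OF equiv_cox_rel])

lemma mem_cls_iff: "v \<in> cls n u \<longleftrightarrow> (u, v) \<in> cox_rel n"
  by (simp add: cls_def)

lemma carrier_W: "carrier (W n) = cls n ` lists {..<n}"
  by (auto simp: W_def cls_def quotient_def)

lemma cls_in_carrier [simp]: "u \<in> lists {..<n} \<Longrightarrow> cls n u \<in> carrier (W n)"
  by (simp add: carrier_W)

lemma cox_rel_append:
  assumes "(u, v) \<in> cox_rel n" "p \<in> lists {..<n}" "q \<in> lists {..<n}"
  shows "(p @ u @ q, p @ v @ q) \<in> cox_rel n"
  using assms
proof (induction rule: cox_rel.induct)
  case (rel u v i j)
  then show ?case using cox_rel.rel [of "p @ u" n "v @ q" i j] by simp
next
  case (trans u v w)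
  then show ?case by (meson cox_rel.trans)
next
  case (refl u)
  then show ?case by (intro cox_rel.refl) simp
qed (auto intro: cox_rel.sym)

lemma cox_rel_append2:
  assumes "(u, u') \<in> cox_rel n" "(v, v') \<in> cox_rel n"
  shows "(u @ v, u' @ v') \<in> cox_rel n"
proof (rule cox_rel.trans)
  show "(u @ v, u' @ v) \<in> cox_rel n"
    using cox_rel_append [OF assms(1), of "[]" v] cox_rel_lists [OF assms(2)] by simp
  show "(u' @ v, u' @ v') \<in> cox_rel n"
    using cox_rel_append [OF assms(2), of u' "[]"] cox_rel_lists [OF assms(1)] by simp
qed

lemma cls_mult [simp]:
  assumes "u \<in> lists {..<n}" "v \<in> lists {..<n}"
  shows "cls n u \<otimes>\<^bsub>W n\<^esub> cls n v = cls n (u @ v)"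
proof -
  have "cls n u \<otimes>\<^bsub>W n\<^esub> cls n v = cox_rel n `` {x @ y | x y. (u, x) \<in> cox_rel n \<and> (v, y) \<in> cox_rel n}"
    by (simp add: W_def cls_def)
  also have "\<dots> = cls n (u @ v)"
  proof
    show "cox_rel n `` {x @ y | x y. (u, x) \<in> cox_rel n \<and> (v, y) \<in> cox_rel n} \<subseteq> cls n (u @ v)"
      by (auto simp: cls_def intro: cox_rel.trans [OF cox_rel_append2])
    show "cls n (u @ v) \<subseteq> cox_rel n `` {x @ y | x y. (u, x) \<in> cox_rel n \<and> (v, y) \<in> cox_rel n}"
      using cox_rel.refl [OF assms(1)] cox_rel.refl [OF assms(2)] by (auto simp: cls_def)
  qed
  finally show ?thesis .
qed

lemma one_W [simp]: "\<one>\<^bsub>W n\<^esub> = cls n []"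
  by (simp add: W_def cls_def)

lemma gen_cls: "gen n i = cls n [i]"
  by (simp add: gen_def cls_def)

lemma cls_cong:
  assumes "cls n u = cls n v" "p \<in> lists {..<n}" "q \<in> lists {..<n}"
    "u \<in> lists {..<n}" "v \<in> lists {..<n}"
  shows "cls n (p @ u @ q) = cls n (p @ v @ q)"
  using assms cox_rel_append by (simp add: cls_eq_iff)

lemma cls_Cons_cong:
  assumes "cls n u = cls n v" "i < n" "u \<in> lists {..<n}" "v \<in> lists {..<n}"
  shows "cls n (i # u) = cls n (i # v)"
  using cls_cong [of n u v "[i]" "[]"] assms by simp

lemma cls_relator:
  assumes "i < n" "j < n"
  shows "cls n (concat (replicate (cox_B i j) [i, j])) = cls n []"
proof -
  have "(concat (replicate (cox_B i j) [i, j]), []) \<in> cox_rel n"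
    using cox_rel.rel [of "[]" n "[]" i j] assms by simp
  then show ?thesis using cls_eq_iff cox_rel_lists by metis
qed

lemma cls_cancel [simp]:
  assumes "i < n" "u \<in> lists {..<n}"
  shows "cls n (i # i # u) = cls n u"
  using cls_cong [OF cls_relator [of i n i], of "[]" u] assms by (simp add: cox_B_def)

lemma rev_lists [simp]: "rev u \<in> lists S \<longleftrightarrow> u \<in> lists S"
  by (auto simp: in_lists_conv_set)

lemma cls_rev_left:
  "u \<in> lists {..<n} \<Longrightarrow> cls n (rev u @ u) = cls n []"
proof (induction u)
  case (Cons i u)
  have "cls n (rev (i # u) @ (i # u)) = cls n (rev u @ [i, i] @ u)" by simp
  also have "\<dots> = cls n (rev u @ [] @ u)"
    using Cons.prems by (intro cls_cong) (auto simp: in_lists_conv_set)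
  finally show ?case using Cons by simp
qed simp

lemma group_W: "group (W n)"
proof (rule groupI)
  fix x y assume "x \<in> carrier (W n)" "y \<in> carrier (W n)"
  then obtain u v where "u \<in> lists {..<n}" "v \<in> lists {..<n}" "x = cls n u" "y = cls n v"
    unfolding carrier_W by blast
  then show "x \<otimes>\<^bsub>W n\<^esub> y \<in> carrier (W n)" by simp
next
  fix x y z assume "x \<in> carrier (W n)" "y \<in> carrier (W n)" "z \<in> carrier (W n)"
  then obtain u v w where "u \<in> lists {..<n}" "v \<in> lists {..<n}" "w \<in> lists {..<n}"
    "x = cls n u" "y = cls n v" "z = cls n w"
    unfolding carrier_W by blast
  then show "x \<otimes>\<^bsub>W n\<^esub> y \<otimes>\<^bsub>W n\<^esub> z = x \<otimes>\<^bsub>W n\<^esub> (y \<otimes>\<^bsub>W n\<^esub> z)" by simp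
next
  fix x assume "x \<in> carrier (W n)"
  then obtain u where "u \<in> lists {..<n}" "x = cls n u" unfolding carrier_W by blast
  then show "\<one>\<^bsub>W n\<^esub> \<otimes>\<^bsub>W n\<^esub> x = x" "\<exists>y\<in>carrier (W n). y \<otimes>\<^bsub>W n\<^esub> x = \<one>\<^bsub>W n\<^esub>"
    by (simp, intro bexI [of _ "cls n (rev u)"]) (simp_all add: cls_rev_left)
qed simp

lemma inv_cls [simp]:
  assumes "u \<in> lists {..<n}" shows "inv\<^bsub>W n\<^esub> (cls n u) = cls n (rev u)"
  by (rule group.inv_equality [OF group_W]) (use assms in \<open>auto simp: cls_rev_left\<close>)

lemma mem_cls_self: "u \<in> lists {..<n} \<Longrightarrow> u \<in> cls n u"
  unfolding mem_cls_iff by (rule cox_rel.refl)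

lemma len_le: "u \<in> lists {..<n} \<Longrightarrow> len (cls n u) \<le> length u"
  unfolding len_def by (rule Least_le) (rule bexI [OF _ mem_cls_self], simp_all)

lemma len_attained:
  assumes "u \<in> lists {..<n}"
  obtains v where "v \<in> cls n u" "length v = len (cls n u)"
proof -
  have "\<exists>v\<in>cls n u. length v = length u" using mem_cls_self [OF assms] by blast
  then have "\<exists>v\<in>cls n u. length v = len (cls n u)" unfolding len_def by (rule LeastI)
  then show ?thesis using that by blast
qed

lemma obtain_reduced:
  assumes "w \<in> carrier (W n)"
  obtains u where "reduced n u" "cls n u = w"
proof -
  obtain u where u: "u \<in> lists {..<n}" "w = cls n u" using assms by (auto simp: carrier_W)
  obtain v where v: "v \<in> cls n u" "length v = len (cls n u)" by (rule len_attained [OF u(1)])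
  have "v \<in> lists {..<n}" using v(1) cox_rel_lists by (auto simp: mem_cls_iff)
  moreover have "cls n v = w" using calculation u v by (metis cls_eq_iff mem_cls_iff)
  ultimately show ?thesis using that [of v] v u by (simp add: reduced_def)
qed

text \<open>
  Every relator \<open>(i j)\<^sup>m\<close> has even length and contains the letter \<open>0\<close> an even number of times. The
  two parities therefore depend on the group element alone. The first shows that multiplication by
  a generator changes the length by exactly one; the second separates elements that involve \<open>t\<close>
  once from elements of the symmetric group.
\<close>

lemma cox_rel_even_length: "(u, v) \<in> cox_rel n \<Longrightarrow> even (length u) = even (length v)"
  by (induction rule: cox_rel.induct) (auto simp: length_concat sum_list_replicate)

lemma count_concat_replicate:
  "count_list (concat (replicate k xs)) x = k * count_list xs x"
  by (induction k) auto

lemma cox_rel_even_count: "(u, v) \<in> cox_rel n \<Longrightarrow> even (count_list u 0) = even (count_list v 0)"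
  by (induction rule: cox_rel.induct)
     (auto simp: count_concat_replicate cox_B_def doubleton_eq_iff)

lemma cls_even_length:
  "u \<in> lists {..<n} \<Longrightarrow> v \<in> lists {..<n} \<Longrightarrow> cls n u = cls n v \<Longrightarrow> even (length u) = even (length v)"
  using cox_rel_even_length by (simp add: cls_eq_iff)

lemma cls_even_count:
  "u \<in> lists {..<n} \<Longrightarrow> v \<in> lists {..<n} \<Longrightarrow> cls n u = cls n v \<Longrightarrow>
   even (count_list u 0) = even (count_list v 0)"
  using cox_rel_even_count by (simp add: cls_eq_iff)

lemma reduced_lists: "reduced n u \<Longrightarrow> u \<in> lists {..<n}"
  by (simp add: reduced_def)

lemma even_len: assumes "u \<in> lists {..<n}" shows "even (len (cls n u)) = even (length u)"
proof -
  obtain v where v: "reduced n v" "cls n v = cls n u" using obtain_reduced [OF cls_in_carrier] assms by blast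
  then show ?thesis using cls_even_length [of u n v] assms by (auto simp: reduced_def)
qed

lemma len_append_le:
  assumes "u \<in> lists {..<n}" "v \<in> lists {..<n}"
  shows "len (cls n (u @ v)) \<le> len (cls n u) + len (cls n v)"
proof -
  obtain u' where u': "reduced n u'" "cls n u' = cls n u" using obtain_reduced [OF cls_in_carrier] assms by blast
  obtain v' where v': "reduced n v'" "cls n v' = cls n v" using obtain_reduced [OF cls_in_carrier] assms by blast
  have "cls n (u @ v) = cls n (u' @ v')"
    using u' v' assms cls_mult [of u n v] cls_mult [of u' n v'] by (simp add: reduced_def)
  then show ?thesis using len_le [of "u' @ v'" n] u' v' by (simp add: reduced_def)
qed

text \<open>
  A generator changes the length by at most one, and it changes the parity of the length.
\<close>

lemma len_gen_mult:
  assumes "i < n" "u \<in> lists {..<n}"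
  shows "len (cls n (i # u)) = len (cls n u) + 1 \<or> len (cls n u) = len (cls n (i # u)) + 1"
proof -
  have "len (cls n (i # u)) \<le> len (cls n u) + 1"
    using len_append_le [of "[i]" n u] len_le [of "[i]" n] assms by simp
  moreover have "len (cls n u) \<le> len (cls n (i # u)) + 1"
    using len_append_le [of "[i]" n "i # u"] len_le [of "[i]" n] assms by simp
  moreover have "even (len (cls n (i # u))) \<noteq> even (len (cls n u))"
    using even_len [of u n] even_len [of "i # u" n] assms by simp
  ultimately show ?thesis by (metis Suc_eq_plus1 le_SucE le_antisym)
qed

lemma reduced_appendD:
  assumes "reduced n (u @ v)" shows "reduced n u" "reduced n v"
  using assms len_append_le [of u n v] len_le [of u n] len_le [of v n] by (auto simp: reduced_def)

lemma reduced_ConsD: "reduced n (i # u) \<Longrightarrow> reduced n u"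
  using reduced_appendD(2) [of n "[i]" u] by simp

lemma len_rev_le:
  assumes "u \<in> lists {..<n}" shows "len (cls n (rev u)) \<le> len (cls n u)"
proof -
  obtain v where v: "reduced n v" "cls n v = cls n u"
    using obtain_reduced [OF cls_in_carrier [OF assms]] .
  have "cls n (rev u) = cls n (rev v)"
    using v inv_cls [OF assms] inv_cls [of v n] by (simp add: reduced_def)
  then show ?thesis using len_le [of "rev v" n] v by (simp add: reduced_def)
qed

lemma len_rev: "u \<in> lists {..<n} \<Longrightarrow> len (cls n (rev u)) = len (cls n u)"
  using len_rev_le [of u n] len_rev_le [of "rev u" n] by simp

lemma reduced_singleton: "i < n \<Longrightarrow> reduced n [i]"
  using even_len [of "[i]" n] len_le [of "[i]" n] by (auto simp: reduced_def le_Suc_eq)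

lemma cls_commute:
  assumes "i < n" "j < n" "i + 2 \<le> j"
  shows "cls n [i, j] = cls n [j, i]"
proof -
  have 2: "concat (replicate (cox_B i j) [i, j]) = [i, j, i, j]"
    using assms by (auto simp: cox_B_def doubleton_eq_iff numeral_2_eq_2)
  have "cls n [j, i] = cls n ([] @ [i, j, i, j] @ [j, i])"
    using assms cls_cong [OF cls_relator [of i n j], of "[]" "[j, i]"] 2 by simp
  also have "\<dots> = cls n ([i, j, i] @ [j, j] @ [i])" by simp
  also have "\<dots> = cls n ([i, j, i] @ [] @ [i])" by (rule cls_cong) (use assms in auto)
  also have "\<dots> = cls n ([i, j] @ [i, i] @ [])" by simp
  also have "\<dots> = cls n ([i, j] @ [] @ [])" by (rule cls_cong) (use assms in auto)
  finally show ?thesis by simp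
qed

lemma cls_braid:
  assumes "1 \<le> i" "Suc i < n"
  shows "cls n [i, Suc i, i] = cls n [Suc i, i, Suc i]"
proof -
  let ?j = "Suc i"
  have 3: "concat (replicate (cox_B i ?j) [i, ?j]) = [i, ?j, i, ?j, i, ?j]"
    using assms by (auto simp: cox_B_def doubleton_eq_iff numeral_3_eq_3)
  have "cls n [?j, i, ?j] = cls n ([] @ [i, ?j, i, ?j, i, ?j] @ [?j, i, ?j])"
    using assms cls_cong [OF cls_relator [of i n ?j], of "[]" "[?j,i,?j]"] 3 by simp
  also have "\<dots> = cls n ([i, ?j, i, ?j, i] @ [?j, ?j] @ [i, ?j])" by simp
  also have "\<dots> = cls n ([i, ?j, i, ?j, i] @ [] @ [i, ?j])" by (rule cls_cong) (use assms in auto)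
  also have "\<dots> = cls n ([i, ?j, i, ?j] @ [i, i] @ [?j])" by simp
  also have "\<dots> = cls n ([i, ?j, i, ?j] @ [] @ [?j])" by (rule cls_cong) (use assms in auto)
  also have "\<dots> = cls n ([i, ?j, i] @ [?j, ?j] @ [])" by simp
  also have "\<dots> = cls n ([i, ?j, i] @ [] @ [])" by (rule cls_cong) (use assms in auto)
  finally show ?thesis by simp
qed

section \<open>Signed permutations and inversions\<close>

text \<open>
  The generators act on the nonzero integers as signed permutations: \<open>t\<close> exchanges \<open>1\<close> and \<open>-1\<close>,
  and \<open>s\<^sub>i\<close> exchanges \<open>i\<close> and \<open>i+1\<close> as well as \<open>-i\<close> and \<open>-i-1\<close>.
\<close>

fun signed_swap :: "nat \<Rightarrow> int \<Rightarrow> int" where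
  "signed_swap 0 x = (if x = 1 then - 1 else if x = - 1 then 1 else x)"
| "signed_swap (Suc k) x =
     (if x = int k + 1 then x + 1 else if x = int k + 2 then x - 1
      else if x = - (int k + 1) then x - 1 else if x = - (int k + 2) then x + 1 else x)"

primrec act :: "nat list \<Rightarrow> int \<Rightarrow> int" where
  "act [] x = x"
| "act (i # u) x = signed_swap i (act u x)"

lemma act_append: "act (u @ v) x = act u (act v x)"
  by (induction u) auto

lemma signed_swap_uminus: "signed_swap i (- x) = - signed_swap i x"
  by (cases i) auto

lemma act_uminus: "act u (- x) = - act u x"
  by (induction u) (auto simp: signed_swap_uminus)

lemma signed_swap_signed_swap: "signed_swap i (signed_swap i x) = x"
  by (cases i) auto

lemma inj_act: "act u x = act u y \<longleftrightarrow> x = y"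
  by (induction u) (auto, metis signed_swap_signed_swap)

lemma signed_swap_commute:
  assumes "i + 2 \<le> j" shows "signed_swap i (signed_swap j x) = signed_swap j (signed_swap i x)"
proof -
  obtain l where l: "j = Suc l" using assms by (cases j) auto
  show ?thesis
  proof (cases i)
    case 0
    show ?thesis
    proof (cases "x \<in> {1, - 1, int l + 1, int l + 2, - (int l + 1), - (int l + 2)}")
      case True then show ?thesis using assms unfolding 0 l by (elim insertE emptyE) simp_all
    next
      case False then show ?thesis using assms unfolding 0 l by simp
    qed
  next
    case (Suc k)
    show ?thesis
    proof (cases "x \<in> {int k + 1, int k + 2, - (int k + 1), - (int k + 2),
                       int l + 1, int l + 2, - (int l + 1), - (int l + 2)}")
      case True then show ?thesis using assms unfolding Suc l by (elim insertE emptyE) simp_all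
    next
      case False then show ?thesis using assms unfolding Suc l by simp
    qed
  qed
qed

lemma signed_swap_braid:
  assumes "1 \<le> i"
  shows "signed_swap i (signed_swap (Suc i) (signed_swap i x)) = signed_swap (Suc i) (signed_swap i (signed_swap (Suc i) x))"
proof -
  obtain k where k: "i = Suc k" using assms by (cases i) auto
  show ?thesis
  proof (cases "x \<in> {int k + 1, int k + 2, int k + 3, - (int k + 1), - (int k + 2), - (int k + 3)}")
    case True then show ?thesis unfolding k by (elim insertE emptyE) simp_all
  next
    case False then show ?thesis unfolding k by simp
  qed
qed

lemma signed_swap_braid4:
  "signed_swap 0 (signed_swap (Suc 0) (signed_swap 0 (signed_swap (Suc 0) x))) = signed_swap (Suc 0) (signed_swap 0 (signed_swap (Suc 0) (signed_swap 0 x)))"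
proof (cases "x \<in> {1, 2, - 1, - 2}")
  case True then show ?thesis by (elim insertE emptyE) simp_all
next
  case False then show ?thesis by simp
qed

lemma act_relator: "act (concat (replicate (cox_B i j) [i, j])) x = x"
proof -
  consider "i = j" | "i = 0" "j = 1" | "i = 1" "j = 0" | "i \<ge> 1" "j = Suc i" | "j \<ge> 1" "i = Suc j"
    | "i + 2 \<le> j" | "j + 2 \<le> i" by linarith
  then show ?thesis
  proof cases
    case 1 then show ?thesis by (simp add: cox_B_def signed_swap_signed_swap)
  next
    case 2
    then have "concat (replicate (cox_B i j) [i, j]) = [0, 1, 0, 1, 0, 1, 0, 1]"
      by (simp add: cox_B_def numeral_eq_Suc)
    then show ?thesis by (simp add: signed_swap_braid4 signed_swap_signed_swap del: signed_swap.simps)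
  next
    case 3
    then have "concat (replicate (cox_B i j) [i, j]) = [1, 0, 1, 0, 1, 0, 1, 0]"
      by (auto simp add: cox_B_def numeral_eq_Suc)
    then show ?thesis by (simp add: signed_swap_braid4 signed_swap_signed_swap del: signed_swap.simps)
  next
    case 4
    then have "concat (replicate (cox_B i j) [i, j]) = [i, j, i, j, i, j]"
      by (auto simp add: cox_B_def doubleton_eq_iff numeral_eq_Suc)
    then show ?thesis using 4 by (simp add: signed_swap_braid signed_swap_signed_swap del: signed_swap.simps)
  next
    case 5
    then have "concat (replicate (cox_B i j) [i, j]) = [i, j, i, j, i, j]"
      by (auto simp add: cox_B_def doubleton_eq_iff numeral_eq_Suc)
    then show ?thesis using 5 by (simp add: signed_swap_braid signed_swap_signed_swap del: signed_swap.simps)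
  next
    case 6
    then have "concat (replicate (cox_B i j) [i, j]) = [i, j, i, j]"
      by (auto simp add: cox_B_def doubleton_eq_iff numeral_eq_Suc)
    then show ?thesis by (simp add: signed_swap_commute [OF 6, of "signed_swap i (signed_swap j x)"] signed_swap_signed_swap del: signed_swap.simps)
  next
    case 7
    then have "concat (replicate (cox_B i j) [i, j]) = [i, j, i, j]"
      by (auto simp add: cox_B_def doubleton_eq_iff numeral_eq_Suc)
    then show ?thesis by (simp add: signed_swap_commute [OF 7, of "signed_swap j x"] signed_swap_signed_swap del: signed_swap.simps)
  qed
qed

lemma cox_rel_act: "(u, v) \<in> cox_rel n \<Longrightarrow> act u = act v"
  by (induction rule: cox_rel.induct) (auto simp: act_append act_relator fun_eq_iff)

text \<open>
  The pairs \<open>(i, j)\<close> with \<open>i \<noteq> 0\<close> and \<open>\<bar>i\<bar> \<le> j\<close>, \<open>i < j\<close> stand for the positive roots of type \<open>B\<close>: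
  \<open>e\<^sub>j - e\<^sub>i\<close> for \<open>i > 0\<close>, \<open>e\<^sub>j + e\<^bsub>-i\<^esub>\<close> for \<open>-j < i < 0\<close>, and \<open>2 e\<^sub>j\<close> for \<open>i = -j\<close>. An inversion is
  a positive root that becomes negative. The set is finite although \<open>j\<close> is unbounded, because a word
  moves only finitely many integers.
\<close>

definition inversions :: "nat list \<Rightarrow> (int \<times> int) set" where
  "inversions u = {(i, j). i \<noteq> 0 \<and> \<bar>i\<bar> \<le> j \<and> i < j \<and> act u j < act u i}"

lemma signed_swap_swaps:
  assumes "x < y" "signed_swap i y < signed_swap i x" "x \<noteq> 0" "y \<noteq> 0"
  shows "if i = 0 then x = - 1 \<and> y = 1 else (x = int i \<and> y = int i + 1 \<or> x = - int i - 1 \<and> y = - int i)"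
  using assms by (cases i) (auto split: if_splits)

text \<open>
  A generator reverses the order of only one pair of values up to sign, so it can create an
  inversion only at a preimage of that pair. The preimages \<open>(i, j)\<close> and \<open>(-j, -i)\<close> describe the same
  root, and the condition \<open>\<bar>i\<bar> \<le> j\<close> selects one of them.
\<close>

lemma inversions_Cons:
  "\<exists>p. inversions (k # u) \<subseteq> insert p (inversions u)"
proof -
  have "p = q" if "p \<in> inversions (k # u) - inversions u" "q \<in> inversions (k # u) - inversions u" for p q
  proof -
    obtain i j i' j' where pq: "p = (i, j)" "q = (i', j')" by (cases p; cases q)
    have 0: "act u 0 = 0" using act_uminus [of u 0] by simp
    have nz: "act u x \<noteq> 0" if "x \<noteq> 0" for x using inj_act [of u x 0] that 0 by simp
    have ij: "i \<noteq> 0" "\<bar>i\<bar> \<le> j" "i < j" "act u i < act u j" "signed_swap k (act u j) < signed_swap k (act u i)"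
      and ij': "i' \<noteq> 0" "\<bar>i'\<bar> \<le> j'" "i' < j'" "act u i' < act u j'" "signed_swap k (act u j') < signed_swap k (act u i')"
      using that inj_act [of u] unfolding pq by (auto simp: inversions_def) (metis not_less_iff_gr_or_eq)+
    have e: "if k = 0 then act u i = - 1 \<and> act u j = 1
        else (act u i = int k \<and> act u j = int k + 1 \<or> act u i = - int k - 1 \<and> act u j = - int k)"
      by (rule signed_swap_swaps) (use ij nz in auto)
    have e': "if k = 0 then act u i' = - 1 \<and> act u j' = 1
        else (act u i' = int k \<and> act u j' = int k + 1 \<or> act u i' = - int k - 1 \<and> act u j' = - int k)"
      by (rule signed_swap_swaps) (use ij' nz in auto)
    have "(act u i = act u i' \<and> act u j = act u j') \<or> (k \<noteq> 0 \<and> act u i = act u (- j') \<and> act u j = act u (- i'))"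
      using e e' by (auto simp: act_uminus split: if_splits)
    then have "(i = i' \<and> j = j') \<or> (k \<noteq> 0 \<and> i = - j' \<and> j = - i')" by (simp add: inj_act)
    then show ?thesis
    proof
      assume *: "k \<noteq> 0 \<and> i = - j' \<and> j = - i'"
      then have "i = - j" using ij ij' by auto
      then have "act u i = - act u j" by (simp add: act_uminus)
      then show ?thesis using e * by (auto split: if_splits)
    qed (simp add: pq)
  qed
  then show ?thesis by blast
qed

lemma card_inversions: "finite (inversions u) \<and> card (inversions u) \<le> length u"
proof (induction u)
  case Nil
  have "inversions [] = {}" by (auto simp: inversions_def)
  then show ?case by simp
next
  case (Cons k u)
  obtain p where p: "inversions (k # u) \<subseteq> insert p (inversions u)" using inversions_Cons by blast
  then have f: "finite (inversions (k # u))" using Cons by (auto intro: finite_subset)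
  have "card (inversions (k # u)) \<le> card (insert p (inversions u))" using p Cons by (intro card_mono) auto
  also have "\<dots> \<le> Suc (card (inversions u))" by (simp add: Cons card_insert_if)
  finally show ?case using Cons f by simp
qed

text \<open>
  The set of inversions depends on the group element alone and is never larger than the length of
  a word for it. A word that already has one inversion per letter is thus of minimal length.
\<close>

lemma reducedI:
  assumes "u \<in> lists {..<n}" "Q \<subseteq> inversions u" "length u \<le> card Q"
  shows "reduced n u"
proof -
  obtain v where v: "reduced n v" "cls n v = cls n u" using obtain_reduced [OF cls_in_carrier] assms by blast
  have "(v, u) \<in> cox_rel n" using v assms cls_eq_iff reduced_lists by blast
  then have "inversions v = inversions u" using cox_rel_act by (simp add: inversions_def)
  then have "card Q \<le> card (inversions v)" using assms card_inversions [of v] by (intro card_mono) auto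
  then have "length u \<le> length v" using assms card_inversions [of v] by simp
  then show ?thesis using v assms len_le [of u n] by (simp add: reduced_def)
qed

section \<open>Reduced normal words\<close>

primrec run :: "(nat \<Rightarrow> nat) \<Rightarrow> nat \<Rightarrow> nat list" where
  "run \<sigma> 0 = []"
| "run \<sigma> (Suc j) = \<sigma> j # run \<sigma> j"

text \<open>
  Normal forms for the elements of \<open>\<langle>s\<^sub>1, \<dots>, s\<^sub>k\<rangle>\<close>, a symmetric group of degree \<open>k+1\<close>. In
  the step from \<open>k\<close> to \<open>k+1\<close> the prefix is \<open>s\<^bsub>k+2-j\<^esub> \<dots> s\<^bsub>k+1\<^esub>\<close>, the minimal representative of a left
  coset of the smaller symmetric group.
\<close>

primrec normal_words :: "nat \<Rightarrow> nat list set" where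
  "normal_words 0 = {[]}"
| "normal_words (Suc k) = {run (\<lambda>j. Suc k - j) j @ u | j u. j \<le> Suc k \<and> u \<in> normal_words k}"

lemma length_run [simp]: "length (run \<sigma> j) = j"
  by (induction j) auto

lemma run_lists: "(\<And>i. i < j \<Longrightarrow> \<sigma> i \<in> S) \<Longrightarrow> run \<sigma> j \<in> lists S"
  by (induction j) auto

lemma normal_words_lists: "u \<in> normal_words k \<Longrightarrow> u \<in> lists {1..k}"
proof (induction k arbitrary: u)
  case (Suc k)
  then obtain j v where u: "u = run (\<lambda>j. Suc k - j) j @ v" "j \<le> Suc k" "v \<in> normal_words k" by auto
  have "v \<in> lists {1..Suc k}" using Suc.IH [OF u(3)] by (auto simp: in_lists_conv_set)
  moreover have "run (\<lambda>j. Suc k - j) j \<in> lists {1..Suc k}"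
    by (rule run_lists) (use u in auto)
  ultimately show ?case using u by simp
qed simp

lemma act_run_desc:
  assumes "j \<le> Suc k" "1 \<le> y"
  shows "act (run (\<lambda>j. Suc k - j) j) y =
    (if y = int k + 2 then int k + 2 - int j
     else if int k + 2 - int j \<le> y \<and> y \<le> int k + 1 then y + 1 else y)"
  using assms(1)
proof (induction j)
  case (Suc j)
  have e: "Suc k - j = Suc (k - j)" using Suc by simp
  have d: "int (k - j) = int k - int j" using Suc by simp
  have IH: "act (run (\<lambda>j. Suc k - j) j) y =
    (if y = int k + 2 then int k + 2 - int j
     else if int k + 2 - int j \<le> y \<and> y \<le> int k + 1 then y + 1 else y)" using Suc by simp
  consider "y = int k + 2" | "y = int k + 1 - int j" | "int k + 2 - int j \<le> y \<and> y \<le> int k + 1"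
    | "y < int k + 1 - int j" | "int k + 2 < y" by linarith
  then show ?case using assms(2) Suc.prems unfolding run.simps act.simps e signed_swap.simps d IH by cases simp_all
qed (use assms in auto)

lemma act_run_asc:
  assumes "1 \<le> y"
  shows "act (run Suc j @ [0]) y =
    (if y = 1 then - (int j + 1) else if y \<le> int j + 1 then y - 1 else y)"
proof (induction j)
  case (Suc j)
  consider "y = 1" | "y = int j + 2" | "1 < y \<and> y \<le> int j + 1" | "y > int j + 2" using assms by linarith
  then show ?case using assms unfolding run.simps act.simps append_Cons Suc.IH signed_swap.simps by cases simp_all
qed (use assms in auto)

lemma card_preimage_self_map:
  assumes "finite A" "inj_on f A" "f ` A \<subseteq> A" "B \<subseteq> A"
  shows "card {i \<in> A. f i \<in> B} = card B"
proof -
  have "f ` A = A" using assms endo_inj_surj by blast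
  then have "f ` {i \<in> A. f i \<in> B} = B" using assms(4) by auto
  then show ?thesis using card_image [of f "{i \<in> A. f i \<in> B}"] assms(2) by (metis (no_types, lifting) inj_on_subset mem_Collect_eq subsetI)
qed

definition pos_inversions :: "nat \<Rightarrow> nat list \<Rightarrow> (int \<times> int) set" where
  "pos_inversions k u = {(i, j). 1 \<le> i \<and> i < j \<and> j \<le> int k + 1 \<and> act u j < act u i}"

lemma finite_pos_inversions [simp]: "finite (pos_inversions k u)"
  by (rule finite_subset [of _ "{1..int k + 1} \<times> {1..int k + 1}"]) (auto simp: pos_inversions_def)

text \<open>
  The prefix \<open>s\<^bsub>k+2-j\<^esub> \<dots> s\<^bsub>k+1\<^esub>\<close> sends the value \<open>k+2\<close> to \<open>k+2-j\<close> and preserves the order of the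
  smaller values. So old inversions persist, and the position \<open>k+2\<close> is inverted with the \<open>j\<close>
  positions whose values were pushed up.
\<close>

lemma act_normal_words:
  assumes "u \<in> normal_words k"
  shows "(\<forall>x. 1 \<le> x \<and> x \<le> int k + 1 \<longrightarrow> 1 \<le> act u x \<and> act u x \<le> int k + 1)
    \<and> (\<forall>x > int k + 1. act u x = x) \<and> length u \<le> card (pos_inversions k u)"
  using assms
proof (induction k arbitrary: u)
  case (Suc k)
  then obtain j v where u: "u = run (\<lambda>j. Suc k - j) j @ v" "j \<le> Suc k" "v \<in> normal_words k" by auto
  have v: "1 \<le> act v x \<and> act v x \<le> int k + 1" if "1 \<le> x" "x \<le> int k + 1" for x
    using Suc.IH [OF u(3)] that by blast
  have v2: "act v x = x" if "x > int k + 1" for x using Suc.IH [OF u(3)] that by blast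
  have v1: "1 \<le> act v x" if "1 \<le> x" for x using v [of x] v2 [of x] that by (cases "x \<le> int k + 1") auto
  have au: "act u x =
      (if x = int k + 2 then int k + 2 - int j
       else if x \<le> int k + 1 \<and> int k + 2 - int j \<le> act v x then act v x + 1 else act v x)"
    if "1 \<le> x" for x
    using act_run_desc [OF u(2) v1 [OF that]] v [of x] v2 [of x] that unfolding u(1) act_append
    by (cases "x \<le> int k + 1") auto
  let ?A = "{1..int k + 1}"
  let ?B = "{int k + 2 - int j..int k + 1}"
  let ?D = "{i \<in> ?A. act v i \<in> ?B}"
  have "card ?D = card ?B"
    by (rule card_preimage_self_map) (use v u in \<open>auto simp: inj_on_def inj_act\<close>)
  then have D: "card ?D = j" by simp
  let ?N = "(\<lambda>i. (i, int k + 2)) ` ?D"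
  have "finite ?D" by (rule finite_subset [of _ ?A]) auto
  then have N: "card ?N = j" "finite ?N" using D by (simp_all add: card_image inj_on_def)
  have dis: "pos_inversions k v \<inter> ?N = {}" by (auto simp: pos_inversions_def)
  have "pos_inversions k v \<union> ?N \<subseteq> pos_inversions (Suc k) u"
    by (auto simp: pos_inversions_def au)
  then have "card (pos_inversions k v \<union> ?N) \<le> card (pos_inversions (Suc k) u)"
    by (intro card_mono) simp_all
  then have "length u \<le> card (pos_inversions (Suc k) u)"
    using Suc.IH [OF u(3)] N dis by (simp add: card_Un_disjoint u(1))
  moreover have "1 \<le> act u x \<and> act u x \<le> int (Suc k) + 1" if "1 \<le> x" "x \<le> int (Suc k) + 1" for x
    using au [OF that(1)] v [of x] that u(2) by (cases "x = int k + 2") auto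
  moreover have "act u x = x" if "x > int (Suc k) + 1" for x using au [of x] v2 [of x] that by auto
  ultimately show ?case by blast
qed simp

lemma reduced_normal_words:
  assumes "u \<in> normal_words k" "k < n" shows "reduced n u"
proof (rule reducedI [where Q = "pos_inversions k u"])
  show "u \<in> lists {..<n}" using normal_words_lists [OF assms(1)] assms(2) by (force simp: in_lists_conv_set)
  show "pos_inversions k u \<subseteq> inversions u" by (auto simp: pos_inversions_def inversions_def)
qed (use act_normal_words [OF assms(1)] in simp)

text \<open>
  Let \<open>p\<close> be the position of the value \<open>1\<close>. The prefix \<open>s\<^sub>j \<dots> s\<^sub>1 t\<close> sends \<open>1\<close> to \<open>-(j+1)\<close> and
  lowers the values \<open>2, \<dots>, j+1\<close> by one. The order of the positive positions does not change, and
  the new inversions are the roots \<open>e\<^sub>p + e\<^sub>q\<close>, for \<open>q\<close> running through the \<open>j+1\<close> positions with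
  value at most \<open>j+1\<close> (and \<open>e\<^sub>p\<close> itself when \<open>q = p\<close>).
\<close>

lemma reduced_normal_words_run_asc:
  assumes "u \<in> normal_words k" "k < n" "j \<le> k" shows "reduced n (run Suc j @ 0 # u)"
proof -
  let ?w = "run Suc j @ 0 # u"
  let ?A = "{1..int k + 1}"
  let ?B = "{1..int j + 1}"
  let ?D = "{i \<in> ?A. act u i \<in> ?B}"
  have u: "1 \<le> act u x \<and> act u x \<le> int k + 1" if "1 \<le> x" "x \<le> int k + 1" for x
    using act_normal_words [OF assms(1)] that by blast
  have aw: "act ?w x = (if act u x = 1 then - (int j + 1) else if act u x \<le> int j + 1 then act u x - 1 else act u x)"
    if "x \<in> ?A" for x
    using act_run_asc [of "act u x" j] u [of x] that by (simp add: act_append)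
  have self: "act u ` ?A \<subseteq> ?A" "inj_on (act u) ?A" using u by (auto simp: inj_on_def inj_act)
  have "card ?D = card ?B" by (rule card_preimage_self_map) (use self assms(3) in auto)
  then have D: "card ?D = Suc j" by simp
  have "act u ` ?A = ?A" by (rule endo_inj_surj) (use self in auto)
  moreover have "1 \<in> ?A" by simp
  ultimately obtain p where p: "p \<in> ?A" "act u p = 1" by (metis imageE)
  let ?f = "\<lambda>q. (- min p q, max p q)"
  let ?N = "?f ` ?D"
  have inj: "inj_on ?f ?D" by (auto simp: inj_on_def min_def max_def split: if_splits)
  have "finite ?D" by (rule finite_subset [of _ ?A]) auto
  then have N: "card ?N = Suc j" "finite ?N" using D card_image [OF inj] by simp_all
  have dis: "pos_inversions k u \<inter> ?N = {}" using p by (auto simp: pos_inversions_def)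
  have "pos_inversions k u \<subseteq> inversions ?w"
  proof
    fix z assume "z \<in> pos_inversions k u"
    then obtain i l where z: "z = (i, l)" "1 \<le> i" "i < l" "l \<le> int k + 1" "act u l < act u i"
      by (auto simp: pos_inversions_def)
    have "act ?w l < act ?w i"
      using aw [of i] aw [of l] z u [of i] u [of l] by auto
    then show "z \<in> inversions ?w" using z by (simp add: inversions_def)
  qed
  moreover have "?N \<subseteq> inversions ?w"
  proof
    fix z assume "z \<in> ?N"
    then obtain q where q: "z = ?f q" "q \<in> ?A" "act u q \<le> int j + 1" by auto
    have "act ?w p = - (int j + 1)" using aw [OF p(1)] p by simp
    moreover have "act ?w q \<le> int j" using aw [OF q(2)] q by auto
    ultimately have "act ?w p < - act ?w q" "act ?w q < - act ?w p" by auto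
    then have "act ?w (max p q) < act ?w (- min p q)" by (auto simp: act_uminus min_def max_def)
    then show "z \<in> inversions ?w" using p q by (auto simp: inversions_def)
  qed
  ultimately show ?thesis
  proof (intro reducedI [where Q = "pos_inversions k u \<union> ?N"])
    show "?w \<in> lists {..<n}"
      using normal_words_lists [OF assms(1)] assms run_lists [of j Suc "{..<n}"] by (force simp: in_lists_conv_set)
    show "length ?w \<le> card (pos_inversions k u \<union> ?N)"
      using act_normal_words [OF assms(1)] N dis by (simp add: card_Un_disjoint)
  qed auto
qed

lemma reduced_commuting:
  assumes "i + 2 \<le> j" "j < n" shows "reduced n [i, j]" "reduced n [j, i]"
proof -
  obtain l where l: "j = Suc l" using assms by (cases j) auto
  have "{(if i = 0 then - 1 else int i, int i + 1), (int l + 1, int l + 2)} \<subseteq> inversions [i, j] \<inter> inversions [j, i]"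
    using assms unfolding l by (cases i) (auto simp: inversions_def)
  moreover have "card {(if i = 0 then - 1 else int i, int i + 1), (int l + 1, int l + 2)} = 2"
    using assms l by auto
  ultimately show "reduced n [i, j]" "reduced n [j, i]"
    using assms by (auto intro!: reducedI [where Q = "{(if i = 0 then - 1 else int i, int i + 1), (int l + 1, int l + 2)}"])
qed

lemma reduced_braid:
  assumes "1 \<le> i" "Suc i < n" shows "reduced n [i, Suc i, i]" "reduced n [Suc i, i, Suc i]"
proof -
  obtain k where k: "i = Suc k" using assms by (cases i) auto
  let ?Q = "{(int k + 1, int k + 2), (int k + 1, int k + 3), (int k + 2, int k + 3)}"
  have "?Q \<subseteq> inversions [i, Suc i, i]" "?Q \<subseteq> inversions [Suc i, i, Suc i]"
    unfolding k by (auto simp: inversions_def)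
  moreover have "card ?Q = 3" by simp
  ultimately show "reduced n [i, Suc i, i]" "reduced n [Suc i, i, Suc i]"
    using assms by (auto intro!: reducedI [where Q = ?Q])
qed

section \<open>Coordinates and the group ring\<close>

lemma lookup_smul: "Poly_Mapping.lookup (smul p x) w = p * Poly_Mapping.lookup x w"
  by (simp add: smul_def Poly_Mapping.map.rep_eq when_def)

lemma smul_add: "smul p (x + y) = smul p x + smul p y"
  by (rule poly_mapping_eqI) (simp add: lookup_smul lookup_add algebra_simps)

lemma smul_diff: "smul p (x - y) = smul p x - smul p y"
  by (rule poly_mapping_eqI) (simp add: lookup_smul lookup_minus algebra_simps)

lemma add_smul: "smul (p + q) x = smul p x + smul q x"
  by (rule poly_mapping_eqI) (simp add: lookup_smul lookup_add algebra_simps)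

lemma diff_smul: "smul (p - q) x = smul p x - smul q x"
  by (rule poly_mapping_eqI) (simp add: lookup_smul lookup_minus algebra_simps)

lemma smul_smul [simp]: "smul p (smul q x) = smul (p * q) x"
  by (rule poly_mapping_eqI) (simp add: lookup_smul algebra_simps)

lemma smul_1 [simp]: "smul 1 x = x"
  by (rule poly_mapping_eqI) (simp add: lookup_smul)

lemma smul_0 [simp]: "smul 0 x = 0" "smul p 0 = 0"
  by (rule poly_mapping_eqI, simp add: lookup_smul)+

lemma smul_sum: "smul p (\<Sum>i\<in>I. f i) = (\<Sum>i\<in>I. smul p (f i))"
  by (induction I rule: infinite_finite_induct) (auto simp: smul_add)

lemma lookup_T: "Poly_Mapping.lookup (T w) y = (if w = y then 1 else 0)"
  by (simp add: T_def lookup_single when_def)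

lemma vpow_add: "vpow (g + h) = vpow g * vpow h"
  by (simp add: vpow_def mult_single)

lemma vpow_0 [simp]: "vpow 0 = 1"
  by (simp add: vpow_def)

lemma lookup_vpow: "Poly_Mapping.lookup (vpow g) h = (if g = h then 1 else 0)"
  by (simp add: vpow_def lookup_single when_def)

lemma ring_bar_vpow: "ring_bar (vpow g) = vpow (- g)"
  by (simp add: ring_bar_def vpow_def)

lemma ring_bar_1 [simp]: "ring_bar 1 = 1"
  using ring_bar_vpow [of 0] by simp

lemma ring_bar_0 [simp]: "ring_bar 0 = 0"
  by (simp add: ring_bar_def)

lemma ring_bar_add: "ring_bar (p + q) = ring_bar p + ring_bar q"
  by (simp add: ring_bar_def frag_extend_add)

lemma ring_bar_diff: "ring_bar (p - q) = ring_bar p - ring_bar q"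
  by (simp add: ring_bar_def frag_extend_diff)

lemma group_ring_induct [case_names zero one diff]:
  fixes p :: "'g group_ring"
  assumes "P 0" "\<And>g. P (vpow g)" "\<And>p q. P p \<Longrightarrow> P q \<Longrightarrow> P (p - q)"
  shows "P p"
  using subset_UNIV [of "Poly_Mapping.keys p"]
  by (induction p rule: frag_induction) (use assms in \<open>auto simp: vpow_def\<close>)

lemma ring_bar_mult: "ring_bar (p * q) = ring_bar p * ring_bar q"
proof (induction p rule: group_ring_induct)
  case (one g)
  show ?case
    by (induction q rule: group_ring_induct)
       (simp_all add: right_diff_distrib ring_bar_diff ring_bar_vpow flip: vpow_add)
qed (simp_all add: left_diff_distrib ring_bar_diff)

lemma lookup_ring_bar: "Poly_Mapping.lookup (ring_bar p) g = Poly_Mapping.lookup p (- g)"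
  by (induction p rule: group_ring_induct)
     (auto simp: ring_bar_diff lookup_minus ring_bar_vpow lookup_vpow)

text \<open>
  The bar involution negates exponents, so an invariant element with only negative exponents has
  none.
\<close>

lemma ring_neg_bar_fixed:
  assumes "p \<in> ring_neg" "ring_bar p = p" shows "p = 0"
proof (rule poly_mapping_eqI)
  fix g
  have "g < 0 \<and> - g < 0" if "Poly_Mapping.lookup p g \<noteq> 0"
  proof -
    have "g \<in> Poly_Mapping.keys p" "- g \<in> Poly_Mapping.keys p"
      using assms(2) that lookup_ring_bar [of p g] by (simp_all add: in_keys_iff)
    then show ?thesis using assms(1) unfolding ring_neg_def by blast
  qed
  then show "Poly_Mapping.lookup p g = Poly_Mapping.lookup 0 g" by force
qed

lemma ring_neg_0 [simp]: "0 \<in> ring_neg"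
  by (simp add: ring_neg_def)

lemma ring_neg_add: "p \<in> ring_neg \<Longrightarrow> q \<in> ring_neg \<Longrightarrow> p + q \<in> ring_neg"
  using keys_add [of p q] by (auto simp: ring_neg_def)

lemma ring_neg_diff: "p \<in> ring_neg \<Longrightarrow> q \<in> ring_neg \<Longrightarrow> p - q \<in> ring_neg"
  using keys_diff [of p q] by (auto simp: ring_neg_def)

lemma ring_neg_mult: "p \<in> ring_neg \<Longrightarrow> q \<in> ring_neg \<Longrightarrow> p * q \<in> ring_neg"
  using keys_mult [of p q] by (fastforce simp: ring_neg_def intro: add_neg_neg)

lemma ring_neg_vpow: "vpow g \<in> ring_neg \<longleftrightarrow> g < 0"
  by (simp add: ring_neg_def vpow_def)

lemma ring_neg_sum: "(\<And>i. i \<in> I \<Longrightarrow> f i \<in> ring_neg) \<Longrightarrow> (\<Sum>i\<in>I. f i) \<in> ring_neg"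
  by (induction I rule: infinite_finite_induct) (auto intro: ring_neg_add)

section \<open>Left multiplication by generators\<close>

locale hecke =
  fixes n :: nat and L :: "nat list set \<Rightarrow> 'g::linordered_ab_group_add"
    and m :: "'g hecke \<Rightarrow> 'g hecke \<Rightarrow> 'g hecke"
  assumes hecke: "hecke_algebra n L m"
begin

abbreviation H :: "'g hecke set" where "H \<equiv> hecke_carrier n"

abbreviation Tw :: "nat list \<Rightarrow> 'g hecke" where "Tw u \<equiv> T (cls n u)"

abbreviation bar :: "'g hecke \<Rightarrow> 'g hecke" where "bar \<equiv> hecke_bar n m"

definition \<tau> :: "nat \<Rightarrow> 'g hecke \<Rightarrow> 'g hecke" where
  "\<tau> i x = m (Tw [i]) x"

definition \<xi> :: "nat \<Rightarrow> 'g group_ring" where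
  "\<xi> i = vpow (L (gen n i)) - vpow (- L (gen n i))"

lemma H_0 [simp]: "0 \<in> H" by (simp add: hecke_carrier_def)

lemma H_add [simp]: "x \<in> H \<Longrightarrow> y \<in> H \<Longrightarrow> x + y \<in> H"
  using keys_add [of x y] by (auto simp: hecke_carrier_def)

lemma H_diff [simp]: "x \<in> H \<Longrightarrow> y \<in> H \<Longrightarrow> x - y \<in> H"
  using keys_diff [of x y] by (auto simp: hecke_carrier_def)

lemma H_smul [simp]: "x \<in> H \<Longrightarrow> smul p x \<in> H"
  by (auto simp: hecke_carrier_def in_keys_iff lookup_smul)

lemma H_T [simp]: "w \<in> carrier (W n) \<Longrightarrow> T w \<in> H"
  by (simp add: hecke_carrier_def T_def)

lemma H_mult [simp]: "x \<in> H \<Longrightarrow> y \<in> H \<Longrightarrow> m x y \<in> H"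
  using hecke by (simp add: hecke_algebra_def)

lemma mult_assoc: "x \<in> H \<Longrightarrow> y \<in> H \<Longrightarrow> z \<in> H \<Longrightarrow> m (m x y) z = m x (m y z)"
  using hecke by (simp add: hecke_algebra_def)

lemma mult_add_left: "x \<in> H \<Longrightarrow> y \<in> H \<Longrightarrow> z \<in> H \<Longrightarrow> m (x + y) z = m x z + m y z"
  using hecke by (simp add: hecke_algebra_def)

lemma mult_add_right: "x \<in> H \<Longrightarrow> y \<in> H \<Longrightarrow> z \<in> H \<Longrightarrow> m x (y + z) = m x y + m x z"
  using hecke by (simp add: hecke_algebra_def)

lemma mult_smul_left: "x \<in> H \<Longrightarrow> y \<in> H \<Longrightarrow> m (smul p x) y = smul p (m x y)"
  using hecke by (simp add: hecke_algebra_def)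

lemma mult_smul_right: "x \<in> H \<Longrightarrow> y \<in> H \<Longrightarrow> m x (smul p y) = smul p (m x y)"
  using hecke by (simp add: hecke_algebra_def)

lemma mult_one: "x \<in> H \<Longrightarrow> m (Tw []) x = x" "x \<in> H \<Longrightarrow> m x (Tw []) = x"
  using hecke by (simp_all add: hecke_algebra_def)

lemma mult_T:
  assumes "u \<in> lists {..<n}" "v \<in> lists {..<n}" "len (cls n (u @ v)) = len (cls n u) + len (cls n v)"
  shows "m (Tw u) (Tw v) = Tw (u @ v)"
proof -
  have "\<forall>w\<in>carrier (W n). \<forall>w'\<in>carrier (W n).
        len (w \<otimes>\<^bsub>W n\<^esub> w') = len w + len w' \<longrightarrow> m (T w) (T w') = T (w \<otimes>\<^bsub>W n\<^esub> w')"
    using hecke by (simp add: hecke_algebra_def)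
  then show ?thesis using assms by (metis cls_in_carrier cls_mult)
qed

lemma mult_diff_right: "x \<in> H \<Longrightarrow> y \<in> H \<Longrightarrow> z \<in> H \<Longrightarrow> m x (y - z) = m x y - m x z"
  using mult_add_right [of x "y - z" z] by simp

lemma mult_diff_left: "x \<in> H \<Longrightarrow> y \<in> H \<Longrightarrow> z \<in> H \<Longrightarrow> m (x - y) z = m x z - m y z"
  using mult_add_left [of "x - y" y z] by simp

lemma T_gen_square: "i < n \<Longrightarrow> m (Tw [i]) (Tw [i]) = Tw [] + smul (\<xi> i) (Tw [i])"
  using hecke by (simp add: hecke_algebra_def gens_def gen_cls \<xi>_def)

lemma \<tau>_H [simp]: "i < n \<Longrightarrow> x \<in> H \<Longrightarrow> \<tau> i x \<in> H"
  by (simp add: \<tau>_def)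

lemma \<tau>_add: "i < n \<Longrightarrow> x \<in> H \<Longrightarrow> y \<in> H \<Longrightarrow> \<tau> i (x + y) = \<tau> i x + \<tau> i y"
  by (simp add: \<tau>_def mult_add_right)

lemma \<tau>_diff: "i < n \<Longrightarrow> x \<in> H \<Longrightarrow> y \<in> H \<Longrightarrow> \<tau> i (x - y) = \<tau> i x - \<tau> i y"
  by (simp add: \<tau>_def mult_diff_right)

lemma \<tau>_smul: "i < n \<Longrightarrow> x \<in> H \<Longrightarrow> \<tau> i (smul p x) = smul p (\<tau> i x)"
  by (simp add: \<tau>_def mult_smul_right)

lemma \<tau>_0 [simp]: "i < n \<Longrightarrow> \<tau> i 0 = 0"
  using \<tau>_smul [of i 0 0] by simp

lemma \<tau>_square: "i < n \<Longrightarrow> x \<in> H \<Longrightarrow> \<tau> i (\<tau> i x) = x + smul (\<xi> i) (\<tau> i x)"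
  by (simp add: \<tau>_def T_gen_square mult_add_left mult_smul_left mult_one flip: mult_assoc)

lemma \<tau>_T_up:
  "i < n \<Longrightarrow> u \<in> lists {..<n} \<Longrightarrow> len (cls n (i # u)) = len (cls n u) + 1 \<Longrightarrow> \<tau> i (Tw u) = Tw (i # u)"
  using mult_T [of "[i]" u] reduced_singleton [of i n] by (simp add: \<tau>_def reduced_def)

lemma \<tau>_T_reduced: "reduced n (i # u) \<Longrightarrow> \<tau> i (Tw u) = Tw (i # u)"
  using \<tau>_T_up [of i u] reduced_ConsD [of n i u] by (simp add: reduced_def)

lemma \<tau>_T_down:
  assumes "i < n" "u \<in> lists {..<n}" "len (cls n u) = len (cls n (i # u)) + 1"
  shows "\<tau> i (Tw u) = Tw (i # u) + smul (\<xi> i) (Tw u)"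
proof -
  have "\<tau> i (Tw (i # u)) = Tw u" using \<tau>_T_up [of i "i # u"] assms by simp
  then show ?thesis using \<tau>_square [of i "Tw (i # u)"] assms by simp
qed

text \<open>
  The relations of the group pass to the operators because both sides are reduced words for one
  element.
\<close>

lemma \<tau>_commute:
  assumes "i + 2 \<le> j" "j < n" "x \<in> H" "reduced n [i, j]" "reduced n [j, i]"
  shows "\<tau> i (\<tau> j x) = \<tau> j (\<tau> i x)"
proof -
  have "m (Tw [i]) (Tw [j]) = Tw [i, j]" "m (Tw [j]) (Tw [i]) = Tw [j, i]"
    using \<tau>_T_reduced [of i "[j]"] \<tau>_T_reduced [of j "[i]"] assms by (simp_all add: \<tau>_def)
  then have "m (Tw [i]) (Tw [j]) = m (Tw [j]) (Tw [i])" using cls_commute [of i n j] assms by simp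
  then show ?thesis using assms mult_assoc [of "Tw [i]" "Tw [j]" x] mult_assoc [of "Tw [j]" "Tw [i]" x]
    by (simp add: \<tau>_def)
qed

lemma \<tau>_braid:
  assumes "1 \<le> i" "Suc i < n" "x \<in> H" "reduced n [i, Suc i, i]" "reduced n [Suc i, i, Suc i]"
  shows "\<tau> i (\<tau> (Suc i) (\<tau> i x)) = \<tau> (Suc i) (\<tau> i (\<tau> (Suc i) x))"
proof -
  have *: "\<tau> i (\<tau> j (\<tau> k x)) = m (Tw [i, j, k]) x"
    if "reduced n [i, j, k]" "i < n" "j < n" "k < n" for i j k
  proof -
    have "m (Tw [i]) (m (Tw [j]) (Tw [k])) = Tw [i, j, k]"
      using \<tau>_T_reduced [of i "[j, k]"] \<tau>_T_reduced [of j "[k]"] that reduced_ConsD by (simp add: \<tau>_def)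
    then show ?thesis using that assms by (simp add: \<tau>_def flip: mult_assoc)
  qed
  show ?thesis using assms by (simp add: * cls_braid)
qed

lemma hecke_induct [consumes 1, case_names zero single add]:
  assumes "x \<in> H" "P 0" "\<And>p u. u \<in> lists {..<n} \<Longrightarrow> P (smul p (Tw u))"
    "\<And>x y. x \<in> H \<Longrightarrow> y \<in> H \<Longrightarrow> P x \<Longrightarrow> P y \<Longrightarrow> P (x + y)"
  shows "P x"
proof -
  let ?f = "\<lambda>w. smul (Poly_Mapping.lookup x w) (T w)"
  have "x = (\<Sum>w\<in>Poly_Mapping.keys x. ?f w)"
  proof (rule poly_mapping_eqI)
    fix y
    have "Poly_Mapping.lookup (\<Sum>w\<in>Poly_Mapping.keys x. ?f w) y
        = (\<Sum>w\<in>Poly_Mapping.keys x. if w = y then Poly_Mapping.lookup x w else 0)"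
      by (simp add: lookup_sum lookup_smul lookup_T if_distrib cong: if_cong)
    then show "Poly_Mapping.lookup x y = Poly_Mapping.lookup (\<Sum>w\<in>Poly_Mapping.keys x. ?f w) y"
      by (simp add: in_keys_iff)
  qed
  moreover have "(\<Sum>w\<in>K. ?f w) \<in> H \<and> P (\<Sum>w\<in>K. ?f w)" if "finite K" "K \<subseteq> carrier (W n)" for K
    using that
  proof (induction K rule: finite_induct)
    case (insert w K)
    then obtain u where "u \<in> lists {..<n}" "w = cls n u" by (auto simp: carrier_W)
    then show ?case using insert assms by simp
  qed (use assms in simp)
  moreover have "Poly_Mapping.keys x \<subseteq> carrier (W n)" using assms(1) by (simp add: hecke_carrier_def)
  ultimately show ?thesis by (metis finite_keys)
qed

text \<open>
  The matrix of \<open>T\<^sub>s\<close>: writing \<open>w\<close> for the class of \<open>u\<close>, the basis element \<open>T\<^sub>w\<close> arises from \<open>T\<^bsub>sw\<^esub>\<close>,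
  and from \<open>T\<^sub>w\<close> itself if multiplication by \<open>s\<close> shortens \<open>w\<close>.
\<close>

lemma lookup_\<tau>:
  assumes "x \<in> H" "i < n" "u \<in> lists {..<n}"
  shows "Poly_Mapping.lookup (\<tau> i x) (cls n u) =
    Poly_Mapping.lookup x (cls n (i # u)) +
    (if len (cls n (i # u)) < len (cls n u) then \<xi> i * Poly_Mapping.lookup x (cls n u) else 0)"
  using assms(1)
proof (induction x rule: hecke_induct)
  case zero
  then show ?case using assms by simp
next
  case (add x y)
  then show ?case using assms by (simp add: \<tau>_add lookup_add algebra_simps)
next
  case (single p v)
  have *: "cls n (i # v) = cls n u \<longleftrightarrow> cls n v = cls n (i # u)"
    using cls_Cons_cong [of n "i # v" u i] cls_Cons_cong [of n v "i # u" i] single assms by auto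
  from len_gen_mult [OF assms(2) single] show ?case
  proof
    assume up: "len (cls n (i # v)) = len (cls n v) + 1"
    then have "\<not> (len (cls n (i # u)) < len (cls n u) \<and> cls n v = cls n u)"
      using cls_Cons_cong [of n u v i] single assms by auto
    then show ?thesis using up single assms by (auto simp: \<tau>_smul \<tau>_T_up lookup_smul lookup_T *)
  next
    assume down: "len (cls n v) = len (cls n (i # v)) + 1"
    then have "cls n v = cls n u \<Longrightarrow> len (cls n (i # u)) < len (cls n u)"
      using cls_Cons_cong [of n u v i] single assms by auto
    then show ?thesis using down single assms
      by (auto simp: \<tau>_smul \<tau>_T_down lookup_smul lookup_add lookup_T * algebra_simps)
  qed
qed

section \<open>The bar involution\<close>

definition inverse_of :: "'g hecke \<Rightarrow> 'g hecke \<Rightarrow> bool" where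
  "inverse_of x y \<longleftrightarrow> y \<in> H \<and> m x y = Tw [] \<and> m y x = Tw []"

lemma hecke_inv_eqI:
  assumes "x \<in> H" "inverse_of x y" shows "hecke_inv n m x = y"
  unfolding hecke_inv_def
proof (rule the_equality)
  fix z assume z: "z \<in> H \<and> m x z = T \<one>\<^bsub>W n\<^esub> \<and> m z x = T \<one>\<^bsub>W n\<^esub>"
  have y: "y \<in> H" "m x y = Tw []" using assms by (simp_all add: inverse_of_def)
  have "z = m z (m x y)" using y z by (simp add: mult_one)
  also have "\<dots> = m (m z x) y" by (rule mult_assoc [symmetric]) (use assms y z in auto)
  also have "\<dots> = y" using y z by (simp add: mult_one)
  finally show "z = y" .
qed (use assms in \<open>simp add: inverse_of_def\<close>)

lemma inverse_of_mult:
  assumes "x \<in> H" "x' \<in> H" "inverse_of x y" "inverse_of x' y'"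
  shows "inverse_of (m x x') (m y' y)"
proof -
  have yH: "y \<in> H" "y' \<in> H" using assms by (simp_all add: inverse_of_def)
  have "m (m x x') (m y' y) = m x (m (m x' y') y)" using assms(1,2) yH by (simp add: mult_assoc)
  moreover have "m (m y' y) (m x x') = m y' (m (m y x) x')" using assms(1,2) yH by (simp add: mult_assoc)
  ultimately show ?thesis using assms yH by (simp add: inverse_of_def mult_one)
qed

lemma inverse_of_gen:
  assumes "i < n" shows "inverse_of (Tw [i]) (Tw [i] - smul (\<xi> i) (Tw []))"
  using assms by (simp add: inverse_of_def T_gen_square mult_diff_right mult_diff_left
      mult_smul_left mult_smul_right mult_one)

text \<open>
  The image \<open>(T\<^bsub>inv w\<^esub>)\<^bsup>-1\<^esup>\<close> of \<open>T\<^sub>w\<close> under the bar involution, for \<open>w\<close> the class of \<open>u\<close>.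
\<close>

definition barT :: "nat list \<Rightarrow> 'g hecke" where
  "barT u = hecke_inv n m (Tw (rev u))"

text \<open>
  Since \<open>T\<^sub>s\<^bsup>-1\<^esup> = T\<^sub>s - \<xi>\<close>, a reduced word \<open>s u\<close> gives
  \<open>(T\<^bsub>inv u\<^esub> T\<^sub>s)\<^bsup>-1\<^esup> = (T\<^sub>s - \<xi>) (T\<^bsub>inv u\<^esub>)\<^bsup>-1\<^esup>\<close>. This also shows by induction that the inverses exist, so
  that \<open>hecke_inv\<close> is not a default value.
\<close>

lemma barT_reduced:
  "reduced n u \<Longrightarrow> barT u \<in> H \<and> inverse_of (Tw (rev u)) (barT u)"
  "reduced n (i # u) \<Longrightarrow> barT (i # u) = \<tau> i (barT u) - smul (\<xi> i) (barT u)"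
proof -
  have step: "inverse_of (Tw (rev (i # u))) (\<tau> i y - smul (\<xi> i) y)"
    if "reduced n (i # u)" "inverse_of (Tw (rev u)) y" for i u y
  proof -
    have in': "i < n" "u \<in> lists {..<n}" using that by (auto simp: reduced_def)
    have "m (Tw (rev u)) (Tw [i]) = Tw (rev (i # u))"
      using mult_T [of "rev u" "[i]"] len_rev [of "i # u" n] len_rev [of u n]
        reduced_singleton [of i n] reduced_ConsD [OF that(1)] that(1) in'
      by (simp add: reduced_def)
    moreover have "inverse_of (m (Tw (rev u)) (Tw [i])) (m (Tw [i] - smul (\<xi> i) (Tw [])) y)"
      using that in' by (intro inverse_of_mult inverse_of_gen) auto
    moreover have "m (Tw [i] - smul (\<xi> i) (Tw [])) y = \<tau> i y - smul (\<xi> i) y"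
      using that in' by (simp add: \<tau>_def mult_diff_left mult_smul_left mult_one inverse_of_def)
    ultimately show ?thesis by simp
  qed
  have inv_barT: "inverse_of (Tw (rev u)) (barT u)" if "reduced n u" for u
    using that
  proof (induction u)
    case Nil
    have "inverse_of (Tw []) (Tw [])" by (simp add: inverse_of_def mult_one)
    then show ?case using hecke_inv_eqI [of "Tw []" "Tw []"] by (simp add: barT_def)
  next
    case (Cons i u)
    then have "inverse_of (Tw (rev (i # u))) (\<tau> i (barT u) - smul (\<xi> i) (barT u))"
      using step reduced_ConsD by blast
    then show ?case using hecke_inv_eqI [of "Tw (rev (i # u))"] Cons.prems reduced_lists [of n "i # u"]
      by (simp add: barT_def)
  qed
  show "reduced n u \<Longrightarrow> barT u \<in> H \<and> inverse_of (Tw (rev u)) (barT u)"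
    using inv_barT by (simp add: inverse_of_def)
  show "barT (i # u) = \<tau> i (barT u) - smul (\<xi> i) (barT u)" if "reduced n (i # u)"
    unfolding barT_def [of "i # u"]
    by (rule hecke_inv_eqI)
       (use step [OF that inv_barT] reduced_ConsD [OF that] reduced_lists [OF that] in simp_all)
qed

lemma barT_cong: "u \<in> lists {..<n} \<Longrightarrow> v \<in> lists {..<n} \<Longrightarrow> cls n u = cls n v \<Longrightarrow> barT u = barT v"
  unfolding barT_def using inv_cls [of u n] inv_cls [of v n] by simp

lemma barT_H: assumes "u \<in> lists {..<n}" shows "barT u \<in> H"
proof -
  obtain v where "reduced n v" "cls n v = cls n u" using obtain_reduced [OF cls_in_carrier [OF assms]] .
  then show ?thesis using barT_reduced(1) [of v] barT_cong [of u v] assms by (simp add: reduced_def)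
qed

lemma barT_up:
  assumes "i < n" "u \<in> lists {..<n}" "len (cls n (i # u)) = len (cls n u) + 1"
  shows "barT (i # u) = \<tau> i (barT u) - smul (\<xi> i) (barT u)"
proof -
  obtain v where v: "reduced n v" "cls n v = cls n u" using obtain_reduced [OF cls_in_carrier [OF assms(2)]] .
  have c: "cls n (i # v) = cls n (i # u)" by (rule cls_Cons_cong) (use v assms reduced_lists in auto)
  then have "reduced n (i # v)" using v assms by (simp add: reduced_def)
  then show ?thesis using barT_reduced(2) [of i v] barT_cong [of u v] barT_cong [of "i # u" "i # v"] v c assms
    by (simp add: reduced_def)
qed

lemma bar_superset:
  assumes "x \<in> H" "finite K" "Poly_Mapping.keys x \<subseteq> K"
  shows "bar x = (\<Sum>w\<in>K. smul (ring_bar (Poly_Mapping.lookup x w)) (hecke_inv n m (T (inv\<^bsub>W n\<^esub> w))))"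
  unfolding hecke_bar_def
  by (rule sum.mono_neutral_left) (use assms in \<open>auto simp: in_keys_iff\<close>)

lemma bar_add:
  assumes "x \<in> H" "y \<in> H" shows "bar (x + y) = bar x + bar y"
proof -
  let ?K = "Poly_Mapping.keys x \<union> Poly_Mapping.keys y"
  show ?thesis using bar_superset [of x ?K] bar_superset [of y ?K] bar_superset [of "x + y" ?K] assms
    keys_add [of x y] by (simp add: lookup_add ring_bar_add add_smul sum.distrib)
qed

lemma bar_smul:
  assumes "x \<in> H" shows "bar (smul p x) = smul (ring_bar p) (bar x)"
proof -
  have "Poly_Mapping.keys (smul p x) \<subseteq> Poly_Mapping.keys x" by (auto simp: in_keys_iff lookup_smul)
  then show ?thesis
    using bar_superset [of "smul p x" "Poly_Mapping.keys x"] bar_superset [of x "Poly_Mapping.keys x"] assms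
    by (simp add: lookup_smul ring_bar_mult smul_sum)
qed

lemma bar_0 [simp]: "bar 0 = 0" by (simp add: hecke_bar_def)

lemma bar_T: "u \<in> lists {..<n} \<Longrightarrow> bar (Tw u) = barT u"
  using bar_superset [OF H_T, of "cls n u" "{cls n u}"] by (simp add: lookup_T barT_def) (simp add: T_def)

lemma bar_one: "bar (Tw []) = Tw []"
proof -
  have "inverse_of (Tw []) (Tw [])" by (simp add: inverse_of_def mult_one)
  then show ?thesis using hecke_inv_eqI [of "Tw []" "Tw []"] by (simp add: barT_def bar_T)
qed

lemma bar_diff: "x \<in> H \<Longrightarrow> y \<in> H \<Longrightarrow> bar (x - y) = bar x - bar y"
  using bar_add [of "x - y" y] by simp

lemma bar_H: "x \<in> H \<Longrightarrow> bar x \<in> H"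
  by (induction x rule: hecke_induct) (simp_all add: bar_smul bar_T barT_H bar_add)

lemma ring_bar_\<xi>: "ring_bar (\<xi> i) = - \<xi> i"
  by (simp add: \<xi>_def ring_bar_diff ring_bar_vpow)

text \<open>
  Multiplicativity of the bar involution for a generator on the left: \<open>T\<^sub>s\<close> goes to
  \<open>T\<^sub>s\<^bsup>-1\<^esup> = T\<^sub>s - \<xi>\<close>.
\<close>

lemma bar_\<tau>:
  assumes "i < n" "x \<in> H" shows "bar (\<tau> i x) = \<tau> i (bar x) - smul (\<xi> i) (bar x)"
  using assms(2)
proof (induction x rule: hecke_induct)
  case (add x y)
  then show ?case using assms by (simp add: \<tau>_add bar_add bar_H smul_add)
next
  case (single p u)
  have "bar (\<tau> i (Tw u)) = \<tau> i (barT u) - smul (\<xi> i) (barT u)"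
    using len_gen_mult [OF assms(1) single]
  proof
    assume "len (cls n (i # u)) = len (cls n u) + 1"
    then show ?thesis using single assms by (simp add: \<tau>_T_up bar_T barT_up)
  next
    assume down: "len (cls n u) = len (cls n (i # u)) + 1"
    let ?y = "barT (i # u)"
    have y: "?y \<in> H" using barT_H single assms by simp
    have u: "barT u = \<tau> i ?y - smul (\<xi> i) ?y"
      using barT_up [of i "i # u"] barT_cong [of "i # i # u" u] down single assms by simp
    have "bar (\<tau> i (Tw u)) = ?y + smul (- \<xi> i) (barT u)"
      using down single assms by (simp add: \<tau>_T_down bar_add bar_smul bar_T ring_bar_\<xi>)
    moreover have "\<tau> i (barT u) = ?y"
      using y assms by (simp add: u \<tau>_diff \<tau>_smul \<tau>_square)
    moreover have "smul (- \<xi> i) z = - smul (\<xi> i) z" for z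
      using diff_smul [of 0 "\<xi> i" z] by simp
    ultimately show ?thesis by simp
  qed
  then show ?case using single assms
    by (simp add: \<tau>_smul bar_smul bar_T barT_H smul_diff mult.commute)
qed (use assms in simp)

text \<open>
  Bruhat-unitriangularity of the bar involution in a coarse form, with the length in place of the
  Bruhat order.
\<close>

lemma barT_unitriangular:
  assumes "reduced n u"
  shows "Poly_Mapping.lookup (barT u) (cls n u) = 1 \<and>
    (\<forall>v\<in>lists {..<n}. length u \<le> len (cls n v) \<longrightarrow> cls n v \<noteq> cls n u \<longrightarrow> Poly_Mapping.lookup (barT u) (cls n v) = 0)"
  using assms
proof (induction u)
  case Nil
  have "barT [] = Tw []" using bar_one by (simp add: bar_T)
  then show ?case by (simp add: lookup_T)
next
  case (Cons i u)
  note red = reduced_ConsD [OF Cons.prems]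
  have i: "i < n" "u \<in> lists {..<n}" using Cons.prems by (auto simp: reduced_def)
  have l: "len (cls n (i # u)) = Suc (length u)" "len (cls n u) = length u"
    using Cons.prems red by (auto simp: reduced_def)
  have e: "Poly_Mapping.lookup (barT (i # u)) (cls n v) =
     Poly_Mapping.lookup (barT u) (cls n (i # v))
     + (if len (cls n (i # v)) < len (cls n v) then \<xi> i * Poly_Mapping.lookup (barT u) (cls n v) else 0)
     - \<xi> i * Poly_Mapping.lookup (barT u) (cls n v)" if "v \<in> lists {..<n}" for v
    using lookup_\<tau> [of "barT u" i v] barT_H i that by (simp add: barT_reduced(2) [OF Cons.prems] lookup_minus lookup_smul)
  have z: "Poly_Mapping.lookup (barT u) (cls n v) = 0" if "v \<in> lists {..<n}" "Suc (length u) \<le> len (cls n v)" for v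
  proof -
    have "cls n v \<noteq> cls n u" using that l by auto
    then show ?thesis using Cons.IH [OF red] that by simp
  qed
  have "Poly_Mapping.lookup (barT (i # u)) (cls n (i # u)) = 1"
    using e [of "i # u"] z [of "i # u"] Cons.IH [OF red] i l by simp
  moreover have "Poly_Mapping.lookup (barT (i # u)) (cls n v) = 0"
    if "v \<in> lists {..<n}" "length (i # u) \<le> len (cls n v)" "cls n v \<noteq> cls n (i # u)" for v
  proof -
    have "cls n (i # v) \<noteq> cls n u" using that cls_Cons_cong [of n "i # v" u i] i by auto
    moreover have "length u \<le> len (cls n (i # v))" using len_gen_mult [OF i(1) that(1)] that(2) by auto
    ultimately have "Poly_Mapping.lookup (barT u) (cls n (i # v)) = 0"
      using Cons.IH [OF red] that i by simp
    then show ?thesis using e [of v] z [of v] that by simp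
  qed
  ultimately show ?case by simp
qed

text \<open>
  At an element of maximal length in the support, unitriangularity makes the coefficient
  bar-invariant, hence zero.
\<close>

lemma bar_fixed_neg_eq_0:
  assumes "x \<in> H" "bar x = x" "\<And>w. Poly_Mapping.lookup x w \<in> ring_neg"
  shows "x = 0"
proof (rule ccontr)
  assume "x \<noteq> 0"
  then have ne: "Poly_Mapping.keys x \<noteq> {}" by simp
  obtain w where w: "w \<in> Poly_Mapping.keys x" "\<forall>y\<in>Poly_Mapping.keys x. len y \<le> len w"
  proof -
    have "Max (len ` Poly_Mapping.keys x) \<in> len ` Poly_Mapping.keys x" using ne by (intro Max_in) auto
    then obtain w where w: "w \<in> Poly_Mapping.keys x" "len w = Max (len ` Poly_Mapping.keys x)" by auto
    moreover have "len y \<le> len w" if "y \<in> Poly_Mapping.keys x" for y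
      using that by (simp add: w(2))
    ultimately show thesis using that by blast
  qed
  let ?c = "Poly_Mapping.lookup x"
  have K: "Poly_Mapping.keys x \<subseteq> carrier (W n)" using assms by (simp add: hecke_carrier_def)
  obtain v where v: "reduced n v" "cls n v = w" using obtain_reduced w K by blast
  have *: "ring_bar (?c y) * Poly_Mapping.lookup (hecke_inv n m (T (inv\<^bsub>W n\<^esub> y))) w = (if y = w then ring_bar (?c w) else 0)"
    if y: "y \<in> Poly_Mapping.keys x" for y
  proof -
    obtain u where u: "reduced n u" "cls n u = y" using obtain_reduced [of y n] y K by blast
    have "hecke_inv n m (T (inv\<^bsub>W n\<^esub> y)) = barT u" using inv_cls [OF reduced_lists [OF u(1)]] u by (simp add: barT_def)
    moreover have "length u \<le> len w" using w y u by (auto simp: reduced_def)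
    ultimately show ?thesis
      using barT_unitriangular [OF u(1)] u v reduced_lists [OF v(1)] by auto
  qed
  have "?c w = Poly_Mapping.lookup (bar x) w" using assms by simp
  also have "\<dots> = (\<Sum>y\<in>Poly_Mapping.keys x. if y = w then ring_bar (?c w) else 0)"
    unfolding hecke_bar_def lookup_sum by (rule sum.cong) (simp_all add: lookup_smul *)
  also have "\<dots> = ring_bar (?c w)" using w by simp
  finally have "?c w = 0" using ring_neg_bar_fixed assms(3) by metis
  then show False using w by (simp add: in_keys_iff)
qed

text \<open>
  Two candidates for \<open>C\<^sub>w\<close> differ by a bar-invariant element with only negative exponents.
\<close>

lemma kl_basis_unique:
  assumes "kl_basis n m C" "w \<in> carrier (W n)" "x \<in> H" "bar x = x"
    "\<And>y. Poly_Mapping.lookup (x - T w) y \<in> ring_neg"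
  shows "C w = x"
proof -
  have C: "C w \<in> H" "bar (C w) = C w" "\<And>y. Poly_Mapping.lookup (C w - T w) y \<in> ring_neg"
    using assms(1,2) by (auto simp: kl_basis_def)
  have "Poly_Mapping.lookup (C w - x) y \<in> ring_neg" for y
    using ring_neg_diff [OF C(3) [of y] assms(5) [of y]] by (simp add: lookup_minus)
  then have "C w - x = 0" using C assms by (intro bar_fixed_neg_eq_0) (auto simp: bar_diff)
  then show ?thesis by simp
qed

end

section \<open>Chains and their weighted sums\<close>

text \<open>
  The generators \<open>s\<^sub>1, \<dots>, s\<^bsub>n-1\<^esub>\<close> have the common weight \<open>a\<close>. The number \<open>r\<close> says how many of them
  enter the construction; the whole construction takes place in the subgroup generated by
  \<open>t, s\<^sub>1, \<dots>, s\<^sub>r\<close>.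
\<close>

locale hecke_type_B = hecke n L m for n L and m :: "'g::linordered_ab_group_add hecke \<Rightarrow> 'g hecke \<Rightarrow> 'g hecke" +
  fixes a :: 'g and r :: nat
  assumes a_pos: "0 < a" and L_gen: "\<And>i. i \<in> {1..<n} \<Longrightarrow> L (gen n i) = a" and r_less: "r < n"
begin

abbreviation v :: "'g group_ring" where "v \<equiv> vpow a"
abbreviation v' :: "'g group_ring" where "v' \<equiv> vpow (- a)"

lemma vv' [simp]: "v * v' = 1" "v' * v = 1"
  by (simp_all flip: vpow_add)

lemma \<xi>_eq: "i \<in> {1..<n} \<Longrightarrow> \<xi> i = v - v'"
  by (simp add: \<xi>_def L_gen)

lemma n_pos: "0 < n" using r_less by simp

definition eigen :: "nat \<Rightarrow> 'g hecke \<Rightarrow> bool" where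
  "eigen i x \<longleftrightarrow> \<tau> i x = smul v x"

text \<open>
  Multiplication by the Kazhdan-Lusztig element \<open>T\<^sub>s + v\<^bsup>-L(s)\<^esup>\<close> of a generator, which is
  bar-invariant.
\<close>

definition kl_gen :: "nat \<Rightarrow> 'g hecke \<Rightarrow> 'g hecke" where
  "kl_gen i x = \<tau> i x + smul (vpow (- L (gen n i))) x"

lemma kl_gen_H: "i < n \<Longrightarrow> x \<in> H \<Longrightarrow> kl_gen i x \<in> H"
  by (simp add: kl_gen_def)

lemma bar_kl_gen:
  assumes "i < n" "x \<in> H" shows "bar (kl_gen i x) = kl_gen i (bar x)"
  using assms by (simp add: kl_gen_def bar_add bar_\<tau> bar_smul ring_bar_vpow \<xi>_def diff_smul)

lemma eigen_add: "i < n \<Longrightarrow> x \<in> H \<Longrightarrow> y \<in> H \<Longrightarrow> eigen i x \<Longrightarrow> eigen i y \<Longrightarrow> eigen i (x + y)"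
  by (simp add: eigen_def \<tau>_add smul_add)

lemma eigen_smul: "i < n \<Longrightarrow> x \<in> H \<Longrightarrow> eigen i x \<Longrightarrow> eigen i (smul p x)"
  by (simp add: eigen_def \<tau>_smul mult.commute)

lemma eigen_commute:
  assumes "i + 2 \<le> j \<or> j + 2 \<le> i" "i < n" "j < n" "x \<in> H" "eigen i x"
  shows "eigen i (\<tau> j x)"
proof -
  have "\<tau> i (\<tau> j x) = \<tau> j (\<tau> i x)"
    using assms(1)
  proof
    assume "i + 2 \<le> j"
    then show ?thesis using \<tau>_commute reduced_commuting assms by blast
  next
    assume "j + 2 \<le> i"
    then show ?thesis using \<tau>_commute [of j i x] reduced_commuting assms by metis
  qed
  then show ?thesis using assms by (simp add: eigen_def \<tau>_smul)
qed

primrec chain :: "(nat \<Rightarrow> nat) \<Rightarrow> 'g hecke \<Rightarrow> nat \<Rightarrow> 'g hecke" where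
  "chain \<sigma> x 0 = x"
| "chain \<sigma> x (Suc j) = \<tau> (\<sigma> j) (chain \<sigma> x j)"

primrec wsum :: "(nat \<Rightarrow> nat) \<Rightarrow> 'g hecke \<Rightarrow> nat \<Rightarrow> 'g hecke" where
  "wsum \<sigma> x 0 = x"
| "wsum \<sigma> x (Suc j) = chain \<sigma> x (Suc j) + smul v' (wsum \<sigma> x j)"

lemma chain_H: "x \<in> H \<Longrightarrow> (\<And>i. i < j \<Longrightarrow> \<sigma> i < n) \<Longrightarrow> chain \<sigma> x j \<in> H"
  by (induction j) auto

lemma wsum_H:
  assumes "x \<in> H" "\<And>i. i < j \<Longrightarrow> \<sigma> i < n" shows "wsum \<sigma> x j \<in> H"
  using assms(2)
proof (induction j)
  case (Suc j)
  then show ?case using chain_H [of x "Suc j" \<sigma>] assms(1) by simp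
qed (use assms(1) in simp)

lemma eigen_wsum:
  assumes "x \<in> H" "\<And>l. l < j \<Longrightarrow> \<sigma> l < n" "i < n" "\<And>l. l \<le> j \<Longrightarrow> eigen i (chain \<sigma> x l)"
  shows "eigen i (wsum \<sigma> x j)"
  using assms(2,4)
proof (induction j)
  case (Suc j)
  have "chain \<sigma> x (Suc j) \<in> H" "wsum \<sigma> x j \<in> H"
    using chain_H [of x "Suc j" \<sigma>] wsum_H [of x j \<sigma>] assms(1) Suc.prems(1) by simp_all
  moreover have "eigen i (chain \<sigma> x (Suc j))" by (rule Suc.prems(2)) simp
  moreover have "eigen i (wsum \<sigma> x j)" using Suc by simp
  ultimately show ?case using assms(3) unfolding wsum.simps by (intro eigen_add eigen_smul) auto
qed simp

text \<open>
  Write \<open>S\<^bsub>j+1\<^esub> = X\<^bsub>j+1\<^esub> + v\<^bsup>-1\<^esup> S\<^sub>j\<close>. The operator \<open>T\<^sub>s\<close> moves \<open>X\<^bsub>j+1\<^esub>\<close> one step along the chain and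
  multiplies \<open>S\<^sub>j\<close> by \<open>v\<close>; the factor \<open>v\<close> cancels against \<open>v\<^bsup>-1\<^esup>\<close>.
\<close>

lemma wsum_three_term:
  assumes "x \<in> H" "\<And>l. l < N \<Longrightarrow> \<sigma> l \<in> {1..<n}"
    and "\<And>i l. i < l \<Longrightarrow> l < N \<Longrightarrow> eigen (\<sigma> l) (chain \<sigma> x i)" "Suc j < N"
  shows "kl_gen (\<sigma> (Suc j)) (wsum \<sigma> x (Suc j)) = wsum \<sigma> x (Suc (Suc j)) + wsum \<sigma> x j"
proof -
  let ?s = "\<sigma> (Suc j)" and ?X = "chain \<sigma> x (Suc j)" and ?S = "wsum \<sigma> x j"
  have n: "\<And>l. l < N \<Longrightarrow> \<sigma> l < n" using assms(2) by force
  have H: "?X \<in> H" "?S \<in> H" using chain_H [of x "Suc j" \<sigma>] wsum_H [of x j \<sigma>] assms(1,4) n by simp_all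
  have s: "?s \<in> {1..<n}" using assms by blast
  have "eigen ?s ?S" by (rule eigen_wsum) (use assms n in auto)
  then have "\<tau> ?s (smul v' ?S) = ?S" using s H by (simp add: eigen_def \<tau>_smul)
  then have "\<tau> ?s (wsum \<sigma> x (Suc j)) = chain \<sigma> x (Suc (Suc j)) + ?S"
    using s H by (simp add: \<tau>_add del: chain.simps) simp
  then show ?thesis using s by (simp add: kl_gen_def L_gen)
qed

text \<open>
  The element \<open>y\<close> is an eigenvector, so \<open>T\<^sub>s + v\<^bsup>-1\<^esup>\<close> multiplies it by \<open>v + v\<^bsup>-1\<^esup>\<close>. The recurrence
  for \<open>q\<close> says that \<open>q\<^sub>j y\<close> obeys the three-term relation of the weighted sums, and invariance
  follows by induction over two consecutive indices.
\<close>

lemma bar_wsum: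
  assumes "x \<in> H" "y \<in> H" "\<And>l. l < N \<Longrightarrow> \<sigma> l \<in> {1..<n}"
    and "\<And>i l. i < l \<Longrightarrow> l < N \<Longrightarrow> eigen (\<sigma> l) (chain \<sigma> x i)"
    and "\<And>l. l < N \<Longrightarrow> eigen (\<sigma> l) y"
    and q: "q 1 = (v + v') * q 0" "\<And>j. q (Suc (Suc j)) = (v + v') * q (Suc j) - q j"
    and "bar (x + smul (q 0) y) = x + smul (q 0) y" "j \<le> N"
  shows "bar (wsum \<sigma> x j + smul (q j) y) = wsum \<sigma> x j + smul (q j) y"
proof -
  let ?E = "\<lambda>j. wsum \<sigma> x j + smul (q j) y"
  have n: "\<And>l. l < N \<Longrightarrow> \<sigma> l < n" using assms(3) by force
  have H: "?E j \<in> H" if "j \<le> N" for j using wsum_H [of x j \<sigma>] assms(1,2) n that by simp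
  have y: "kl_gen (\<sigma> l) (smul p y) = smul ((v + v') * p) y" if "l < N" for l p
    using assms(2) assms(3,5) [OF that]
    by (simp add: kl_gen_def eigen_def \<tau>_smul L_gen algebra_simps add_smul)
  have add: "kl_gen i (z + z') = kl_gen i z + kl_gen i z'" if "i < n" "z \<in> H" "z' \<in> H" for i z z'
    using that by (simp add: kl_gen_def \<tau>_add smul_add)
  have "(j \<le> N \<longrightarrow> bar (?E j) = ?E j) \<and> (Suc j \<le> N \<longrightarrow> bar (?E (Suc j)) = ?E (Suc j))" for j
  proof (induction j)
    case 0
    have "bar (?E 1) = ?E 1" if "0 < N"
    proof -
      have "?E 1 = kl_gen (\<sigma> 0) (?E 0)"
        using assms(1,2) assms(3) [OF that] q(1) by (simp add: add y [OF that]) (simp add: kl_gen_def L_gen)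
      then show ?thesis using assms(8) bar_kl_gen [of "\<sigma> 0" "?E 0"] n [OF that] H [of 0] by simp
    qed
    then show ?case using assms(8) by simp
  next
    case (Suc j)
    have "bar (?E (Suc (Suc j))) = ?E (Suc (Suc j))" if "Suc (Suc j) \<le> N"
    proof -
      have "kl_gen (\<sigma> (Suc j)) (wsum \<sigma> x (Suc j)) = wsum \<sigma> x (Suc (Suc j)) + wsum \<sigma> x j"
        by (rule wsum_three_term [of x N]) (use assms that in auto)
      then have "?E (Suc (Suc j)) = kl_gen (\<sigma> (Suc j)) (?E (Suc j)) - ?E j"
        using assms(1,2) that n wsum_H [of x "Suc j" \<sigma>]
        by (simp add: add y q(2) diff_smul del: wsum.simps)
      moreover have "bar (kl_gen (\<sigma> (Suc j)) (?E (Suc j)) - ?E j) = kl_gen (\<sigma> (Suc j)) (?E (Suc j)) - ?E j"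
        using Suc that n H bar_kl_gen [of "\<sigma> (Suc j)" "?E (Suc j)"]
          bar_diff [of "kl_gen (\<sigma> (Suc j)) (?E (Suc j))" "?E j"] kl_gen_H by (simp del: wsum.simps)
      ultimately show ?thesis by simp
    qed
    then show ?case using Suc by simp
  qed
  then show ?thesis using assms(9) by blast
qed

section \<open>Leading terms\<close>

text \<open>
  The element is \<open>T\<^sub>w\<close>, for \<open>w\<close> the class of \<open>u\<close>, plus shorter terms with negative exponents. The
  bound on the length keeps the leading coefficient equal to \<open>1\<close> when weighted sums are formed.
\<close>

definition dominated :: "'g hecke \<Rightarrow> nat list \<Rightarrow> bool" where
  "dominated x u \<longleftrightarrow> Poly_Mapping.lookup x (cls n u) = 1 \<and>
     (\<forall>w. w \<noteq> cls n u \<longrightarrow> Poly_Mapping.lookup x w \<in> ring_neg) \<and>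
     (\<forall>w\<in>Poly_Mapping.keys x. w \<noteq> cls n u \<longrightarrow> len w < length u)"

lemma keys_T: "Poly_Mapping.keys (T w :: 'g hecke) = {w}"
  by (simp add: T_def)

lemma lookup_outside: "x \<in> H \<Longrightarrow> w \<notin> carrier (W n) \<Longrightarrow> Poly_Mapping.lookup x w = 0"
  by (auto simp: hecke_carrier_def in_keys_iff)

text \<open>
  If \<open>s\<close> lengthens every element of the support, \<open>T\<^sub>s\<close> merely translates the coefficients.
\<close>

lemma lookup_\<tau>_reduced:
  assumes "x \<in> H" "i < n" "Poly_Mapping.keys x \<subseteq> cls n ` U" "\<And>u. u \<in> U \<Longrightarrow> reduced n (i # u)" "u \<in> lists {..<n}"
  shows "Poly_Mapping.lookup (\<tau> i x) (cls n u) = Poly_Mapping.lookup x (cls n (i # u))"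
proof -
  have "Poly_Mapping.lookup x (cls n u) = 0" if "len (cls n (i # u)) < len (cls n u)"
  proof (rule ccontr)
    assume "Poly_Mapping.lookup x (cls n u) \<noteq> 0"
    then obtain u' where u': "u' \<in> U" "cls n u = cls n u'" using assms(3) by (auto simp: in_keys_iff)
    then have "cls n (i # u) = cls n (i # u')"
      using cls_Cons_cong assms(2,5) reduced_lists [OF reduced_ConsD [OF assms(4)]] by blast
    moreover have "len (cls n (i # u')) = Suc (len (cls n u'))"
      using assms(4) [OF u'(1)] reduced_ConsD [OF assms(4) [OF u'(1)]] by (simp add: reduced_def)
    ultimately show False using that u' by simp
  qed
  then show ?thesis using lookup_\<tau> [OF assms(1,2,5)] by simp
qed

lemma keys_\<tau>_reduced:
  assumes "x \<in> H" "i < n" "Poly_Mapping.keys x \<subseteq> cls n ` U" "\<And>u. u \<in> U \<Longrightarrow> reduced n (i # u)"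
  shows "Poly_Mapping.keys (\<tau> i x) \<subseteq> cls n ` (#) i ` U"
proof
  fix w assume w: "w \<in> Poly_Mapping.keys (\<tau> i x)"
  moreover have "\<tau> i x \<in> H" using assms by simp
  ultimately obtain u where u: "u \<in> lists {..<n}" "w = cls n u"
    using carrier_W by (force simp: hecke_carrier_def)
  have "Poly_Mapping.lookup (\<tau> i x) (cls n u) = Poly_Mapping.lookup x (cls n (i # u))"
    by (rule lookup_\<tau>_reduced [OF assms(1-3) _ u(1)]) (rule assms(4))
  then have "Poly_Mapping.lookup x (cls n (i # u)) \<noteq> 0" using w u by (simp add: in_keys_iff)
  then obtain u' where u': "u' \<in> U" "cls n (i # u) = cls n u'" using assms(3) by (auto simp: in_keys_iff)
  have "cls n (i # i # u) = cls n (i # u')"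
    by (rule cls_Cons_cong) (use u u' assms reduced_lists [OF reduced_ConsD [OF assms(4)]] in auto)
  then show "w \<in> cls n ` (#) i ` U" using u u' assms(2) by auto
qed

lemma dominated_\<tau>:
  assumes "x \<in> H" "i < n" "Poly_Mapping.keys x \<subseteq> cls n ` U" "\<And>u. u \<in> U \<Longrightarrow> reduced n (i # u)"
    and "dominated x u" "reduced n (i # u)"
  shows "dominated (\<tau> i x) (i # u)"
proof -
  have u: "u \<in> lists {..<n}" using assms(6) by (simp add: reduced_def)
  have l: "Poly_Mapping.lookup (\<tau> i x) (cls n u) = Poly_Mapping.lookup x (cls n (i # u))"
    if "u \<in> lists {..<n}" for u
    by (rule lookup_\<tau>_reduced [OF assms(1-3) _ that]) (rule assms(4))
  have "Poly_Mapping.lookup (\<tau> i x) (cls n (i # u)) = 1"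
    using l [of "i # u"] assms u by (simp add: dominated_def)
  moreover have "Poly_Mapping.lookup (\<tau> i x) w \<in> ring_neg \<and> (w \<in> Poly_Mapping.keys (\<tau> i x) \<longrightarrow> len w < length (i # u))"
    if "w \<noteq> cls n (i # u)" for w
  proof (cases "w \<in> carrier (W n)")
    case True
    then obtain v where v: "w = cls n v" "v \<in> lists {..<n}" by (auto simp: carrier_W)
    have ne: "cls n (i # v) \<noteq> cls n u" using that v u assms(2) cls_Cons_cong [of n "i # v" u i] by auto
    have "len w \<le> len (cls n (i # v)) + 1" using len_gen_mult [OF assms(2) v(2)] v by auto
    moreover have "len (cls n (i # v)) < length u" if "cls n (i # v) \<in> Poly_Mapping.keys x"
      using assms(5) ne that by (simp add: dominated_def)
    ultimately show ?thesis using assms(5) ne l [OF v(2)] v by (auto simp: dominated_def in_keys_iff)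
  qed (use assms lookup_outside [of "\<tau> i x"] in \<open>simp add: in_keys_iff\<close>)
  ultimately show ?thesis unfolding dominated_def by blast
qed

lemma dominated_add:
  assumes "dominated x u" "reduced n u" "dominated y u'" "reduced n u'" "length u' < length u"
  shows "dominated (x + smul v' y) u"
proof -
  have y0: "len w < length u" if "w \<in> Poly_Mapping.keys y" for w
    using that assms(3-5) by (cases "w = cls n u'") (auto simp: dominated_def reduced_def)
  have neg: "v' \<in> ring_neg" using a_pos by (simp add: ring_neg_vpow)
  have y1: "v' * Poly_Mapping.lookup y w \<in> ring_neg" for w
    using assms(3) neg by (cases "w = cls n u'") (auto simp: dominated_def intro: ring_neg_mult)
  have "cls n u \<notin> Poly_Mapping.keys y" using y0 [of "cls n u"] assms(2) by (auto simp: reduced_def)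
  then have "Poly_Mapping.lookup (x + smul v' y) (cls n u) = 1"
    using assms(1) by (simp add: dominated_def lookup_add lookup_smul in_keys_iff)
  moreover have "Poly_Mapping.lookup (x + smul v' y) w \<in> ring_neg" if "w \<noteq> cls n u" for w
    using assms(1) that y1 by (simp add: dominated_def lookup_add lookup_smul ring_neg_add)
  moreover have "len w < length u" if "w \<in> Poly_Mapping.keys (x + smul v' y)" "w \<noteq> cls n u" for w
  proof -
    have "w \<in> Poly_Mapping.keys x \<or> w \<in> Poly_Mapping.keys y"
      using that(1) by (auto simp: in_keys_iff lookup_add lookup_smul)
    then show ?thesis using assms(1) y0 that(2) by (auto simp: dominated_def)
  qed
  ultimately show ?thesis unfolding dominated_def by blast
qed

lemma dominated_chain:
  assumes "x \<in> H" "\<And>i. i < j \<Longrightarrow> \<sigma> i < n" "Poly_Mapping.keys x \<subseteq> cls n ` U"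
    and "\<And>i u. i \<le> j \<Longrightarrow> u \<in> U \<Longrightarrow> reduced n (run \<sigma> i @ u)" "u \<in> U" "dominated x u"
  shows "dominated (chain \<sigma> x j) (run \<sigma> j @ u) \<and>
    Poly_Mapping.keys (chain \<sigma> x j) \<subseteq> cls n ` {run \<sigma> j @ u | u. u \<in> U}"
  using assms(2,4)
proof (induction j)
  case 0
  then show ?case using assms by simp
next
  case (Suc j)
  let ?V = "{run \<sigma> j @ u | u. u \<in> U}"
  have IH: "dominated (chain \<sigma> x j) (run \<sigma> j @ u)" "Poly_Mapping.keys (chain \<sigma> x j) \<subseteq> cls n ` ?V"
    using Suc by auto
  have H: "chain \<sigma> x j \<in> H" by (rule chain_H) (use Suc assms in auto)
  have r: "reduced n (\<sigma> j # u)" if "u \<in> ?V" for u using that Suc.prems(2) [of "Suc j"] by auto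
  have "dominated (\<tau> (\<sigma> j) (chain \<sigma> x j)) (\<sigma> j # run \<sigma> j @ u)"
    by (rule dominated_\<tau> [OF H _ IH(2) r IH(1)]) (use Suc.prems assms(5) r in auto)
  moreover have "Poly_Mapping.keys (\<tau> (\<sigma> j) (chain \<sigma> x j)) \<subseteq> cls n ` (#) (\<sigma> j) ` ?V"
    by (rule keys_\<tau>_reduced [OF H _ IH(2) r]) (use Suc.prems in auto)
  moreover have "(#) (\<sigma> j) ` ?V = {run \<sigma> (Suc j) @ u | u. u \<in> U}" by auto
  ultimately show ?case by simp
qed

lemma dominated_wsum:
  assumes "x \<in> H" "\<And>i. i < j \<Longrightarrow> \<sigma> i < n" "Poly_Mapping.keys x \<subseteq> cls n ` U"
    and "\<And>i u. i \<le> j \<Longrightarrow> u \<in> U \<Longrightarrow> reduced n (run \<sigma> i @ u)" "u \<in> U" "dominated x u"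
  shows "dominated (wsum \<sigma> x j) (run \<sigma> j @ u) \<and>
    Poly_Mapping.keys (wsum \<sigma> x j) \<subseteq> cls n ` {run \<sigma> i @ u | i u. i \<le> j \<and> u \<in> U}"
  using assms(2,4)
proof (induction j)
  case 0
  then show ?case using assms by simp
next
  case (Suc j)
  have c: "dominated (chain \<sigma> x (Suc j)) (run \<sigma> (Suc j) @ u) \<and>
    Poly_Mapping.keys (chain \<sigma> x (Suc j)) \<subseteq> cls n ` {run \<sigma> (Suc j) @ u | u. u \<in> U}"
    by (rule dominated_chain) (use assms Suc.prems in auto)
  have IH: "dominated (wsum \<sigma> x j) (run \<sigma> j @ u)"
    "Poly_Mapping.keys (wsum \<sigma> x j) \<subseteq> cls n ` {run \<sigma> i @ u | i u. i \<le> j \<and> u \<in> U}"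
    using Suc by auto
  have "dominated (chain \<sigma> x (Suc j) + smul v' (wsum \<sigma> x j)) (run \<sigma> (Suc j) @ u)"
    by (rule dominated_add [OF _ _ IH(1)]) (use c Suc.prems(2) assms(5) in \<open>auto simp del: run.simps\<close>)
  moreover have "Poly_Mapping.keys (wsum \<sigma> x (Suc j)) \<subseteq> cls n ` {run \<sigma> i @ u | i u. i \<le> Suc j \<and> u \<in> U}"
  proof (rule subset_trans)
    show "Poly_Mapping.keys (wsum \<sigma> x (Suc j)) \<subseteq> Poly_Mapping.keys (chain \<sigma> x (Suc j)) \<union> Poly_Mapping.keys (wsum \<sigma> x j)"
      by (auto simp: in_keys_iff lookup_add lookup_smul)
    have "cls n ` {run \<sigma> (Suc j) @ u | u. u \<in> U} \<union> cls n ` {run \<sigma> i @ u | i u. i \<le> j \<and> u \<in> U}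
      \<subseteq> cls n ` {run \<sigma> i @ u | i u. i \<le> Suc j \<and> u \<in> U}"
      unfolding image_Un [symmetric] by (rule image_mono) (use le_SucI in blast)
    then show "Poly_Mapping.keys (chain \<sigma> x (Suc j)) \<union> Poly_Mapping.keys (wsum \<sigma> x j)
      \<subseteq> cls n ` {run \<sigma> i @ u | i u. i \<le> Suc j \<and> u \<in> U}"
      by (rule subset_trans [OF Un_mono [OF conjunct2 [OF c] IH(2)]])
  qed
  ultimately show ?case by simp
qed

section \<open>The longest element of the symmetric group\<close>

text \<open>
  The Kazhdan-Lusztig element of the longest element of \<open>\<langle>s\<^sub>1, \<dots>, s\<^sub>k\<rangle>\<close>, summed coset by coset.
\<close>

primrec C_sym :: "nat \<Rightarrow> 'g hecke" where
  "C_sym 0 = Tw []"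
| "C_sym (Suc k) = wsum (\<lambda>j. Suc k - j) (C_sym k) (Suc k)"

primrec longest_word :: "nat \<Rightarrow> nat list" where
  "longest_word 0 = []"
| "longest_word (Suc k) = run (\<lambda>j. Suc k - j) (Suc k) @ longest_word k"

lemma longest_word_normal_words: "longest_word k \<in> normal_words k"
proof (induction k)
  case (Suc k)
  then show ?case unfolding longest_word.simps normal_words.simps by blast
qed simp

lemma C_sym_H: "k < n \<Longrightarrow> C_sym k \<in> H"
proof (induction k)
  case (Suc k)
  then show ?case unfolding C_sym.simps by (intro wsum_H) auto
qed simp

lemma C_sym_dominated:
  "k < n \<Longrightarrow> dominated (C_sym k) (longest_word k) \<and> Poly_Mapping.keys (C_sym k) \<subseteq> cls n ` normal_words k"
proof (induction k)
  case 0
  show ?case by (simp add: dominated_def lookup_T keys_T)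
next
  case (Suc k)
  show ?case unfolding C_sym.simps longest_word.simps normal_words.simps
  proof (rule dominated_wsum)
    show "reduced n (run (\<lambda>j. Suc k - j) i @ u)" if "i \<le> Suc k" "u \<in> normal_words k" for i u
      by (rule reduced_normal_words [of _ "Suc k"]) (use that Suc.prems in auto)
  qed (use Suc C_sym_H longest_word_normal_words in auto)
qed

text \<open>
  The chain starts at an eigenvector, and it reaches index \<open>i\<close> by means of \<open>s\<^bsub>k+2-i\<^esub>, \<dots>, s\<^bsub>k+1\<^esub>\<close>,
  which commute with \<open>s\<^bsub>k+1-l\<^esub>\<close> for \<open>i < l\<close>.
\<close>

lemma C_sym_chain_eigen:
  assumes "Suc k < n" "\<And>p. p \<in> {1..k} \<Longrightarrow> eigen p (C_sym k)" "i < l" "l \<le> k"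
  shows "eigen (Suc k - l) (chain (\<lambda>j. Suc k - j) (C_sym k) i)"
  using assms(3)
proof (induction i)
  case 0
  then have "Suc k - l \<in> {1..k}" using assms(4) by auto
  then show ?case using assms(2) by simp
next
  case (Suc i)
  have "chain (\<lambda>j. Suc k - j) (C_sym k) i \<in> H" by (rule chain_H) (use assms C_sym_H in auto)
  then show ?case using Suc assms unfolding chain.simps by (intro eigen_commute) auto
qed

text \<open>
  Let \<open>p = k+1-j\<close>, so that \<open>T\<^sub>p\<close> carries \<open>X\<^sub>j\<close> to \<open>X\<^bsub>j+1\<^esub>\<close>. The elements \<open>X\<^sub>i\<close> with \<open>i < j\<close> are
  eigenvectors because \<open>s\<^sub>p\<close> commutes past the chain. For \<open>i = j+2\<close> the braid relation
  \<open>T\<^sub>p T\<^bsub>p-1\<^esub> T\<^sub>p = T\<^bsub>p-1\<^esub> T\<^sub>p T\<^bsub>p-1\<^esub>\<close> reduces the claim to the eigenvector property of \<open>X\<^sub>j\<close> for \<open>p-1\<close>,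
  and later generators commute with \<open>s\<^sub>p\<close> again. The two remaining terms \<open>X\<^bsub>j+1\<^esub> + v\<^bsup>-1\<^esup> X\<^sub>j\<close> form an
  eigenvector by the quadratic relation.
\<close>

lemma C_sym_eigen:
  "k < n \<Longrightarrow> p \<in> {1..k} \<Longrightarrow> eigen p (C_sym k)"
proof (induction k arbitrary: p)
  case (Suc k)
  note k = Suc.prems(1)
  let ?\<sigma> = "\<lambda>j. Suc k - j"
  let ?X = "chain ?\<sigma> (C_sym k)" and ?S = "wsum ?\<sigma> (C_sym k)"
  have IH: "\<And>p. p \<in> {1..k} \<Longrightarrow> eigen p (C_sym k)" using Suc by simp
  note ce = C_sym_chain_eigen [OF Suc.prems(1) IH]
  define j where "j = Suc k - p"
  have j: "j \<le> k" "p = Suc k - j" and p: "p \<in> {1..<n}" using Suc.prems by (auto simp: j_def)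
  have XH: "?X i \<in> H" for i by (rule chain_H) (use Suc.prems C_sym_H in auto)
  have SH: "?S i \<in> H" for i by (rule wsum_H) (use Suc.prems C_sym_H in auto)
  have Xj: "\<tau> p (?X j) = ?X (Suc j)" using j by simp
  have XSj: "\<tau> p (?X (Suc j)) = ?X j + smul (v - v') (?X (Suc j))"
    using Xj \<tau>_square [of p "?X j"] p XH \<xi>_eq [OF p] by (simp del: chain.simps)
  \<comment> \<open>\<open>R\<close> collects the terms of \<open>S\<^sub>j\<close> with index less than \<open>j\<close>; there are none if \<open>j = 0\<close>.\<close>
  obtain R where R: "R \<in> H" "?S j = ?X j + R" "eigen p R"
  proof (cases j)
    case 0
    have "eigen p 0" using p by (simp add: eigen_def)
    then show ?thesis using that [of 0] 0 by simp
  next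
    case (Suc j')
    have "eigen p (?X l)" if "l \<le> j'" for l using ce [of l j] that Suc j by simp
    then have "eigen p (?S j')"
      by (intro eigen_wsum) (use Suc j Suc.prems k C_sym_H in auto)
    then have "eigen p (smul v' (?S j'))" using SH p by (intro eigen_smul) auto
    then show ?thesis using that [of "smul v' (?S j')"] Suc SH by simp
  qed
  have base: "eigen p (?S (Suc j))"
  proof -
    have "\<tau> p R = smul v R" using R by (simp add: eigen_def)
    then show ?thesis using R p XH Xj XSj
      by (simp add: eigen_def \<tau>_add \<tau>_smul smul_add diff_smul del: chain.simps)
  qed
  have up: "eigen p (?X (Suc (Suc j) + i))" if "Suc (j + i) \<le> k" for i
    using that
  proof (induction i)
    case 0
    define q where "q = k - j"
    have q: "p = Suc q" "?\<sigma> (Suc j) = q" "1 \<le> q" using 0 j by (auto simp: q_def)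
    have "eigen q (?X j)" using ce [of j "Suc j"] 0 q by simp
    then have "\<tau> p (\<tau> q (\<tau> p (?X j))) = \<tau> q (\<tau> p (smul v (?X j)))"
      using \<tau>_braid [of q "?X j"] reduced_braid [of q n] q p XH by (simp add: eigen_def)
    also have "\<dots> = smul v (\<tau> q (\<tau> p (?X j)))" using q p XH by (simp add: \<tau>_smul)
    finally have "eigen p (\<tau> q (?X (Suc j)))" using Xj by (simp add: eigen_def del: chain.simps)
    then show ?case using q by simp
  next
    case (Suc i)
    have "eigen p (\<tau> (?\<sigma> (Suc (Suc j) + i)) (?X (Suc (Suc j) + i)))"
      by (rule eigen_commute) (use Suc XH p j in auto)
    then show ?case by simp
  qed
  have "eigen p (?S (Suc j + i))" if "j + i \<le> k" for i
    using that
  proof (induction i)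
    case 0
    then show ?case using base by simp
  next
    case (Suc i)
    have "eigen p (?X (Suc (Suc j) + i))" using up [of i] Suc.prems by simp
    then have "eigen p (?X (Suc (Suc j) + i) + smul v' (?S (Suc j + i)))"
      using Suc XH SH p by (intro eigen_add eigen_smul) (simp_all del: chain.simps wsum.simps)
    then show ?case by (simp del: chain.simps)
  qed
  from this [of "k - j"] show ?case using j by (simp del: wsum.simps)
qed simp

lemma C_sym_bar: "k < n \<Longrightarrow> bar (C_sym k) = C_sym k"
proof (induction k)
  case (Suc k)
  have "bar (wsum (\<lambda>j. Suc k - j) (C_sym k) (Suc k) + smul ((\<lambda>_. 0) (Suc k)) 0)
    = wsum (\<lambda>j. Suc k - j) (C_sym k) (Suc k) + smul ((\<lambda>_. 0) (Suc k)) 0"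
  proof (rule bar_wsum [where N = "Suc k"])
    show "eigen (Suc k - l) (chain (\<lambda>j. Suc k - j) (C_sym k) i)" if "i < l" "l < Suc k" for i l
      by (rule C_sym_chain_eigen) (use that Suc.prems C_sym_eigen in auto)
    show "eigen (Suc k - l) 0" if "l < Suc k" for l using that Suc.prems by (simp add: eigen_def)
  qed (use Suc C_sym_H in auto)
  then show ?case by simp
qed (simp add: bar_one)

section \<open>A Kazhdan-Lusztig element of type \<open>B\<close>\<close>

text \<open>
  The twisted quantum integer \<open>V\<^bsup>-1\<^esup> (v\<^sup>k + v\<^bsup>k-2\<^esup> + \<dots> + v\<^bsup>-k\<^esup>)\<close>.
\<close>

definition qcoef :: "nat \<Rightarrow> 'g group_ring" where
  "qcoef k = (\<Sum>j\<le>k. vpow (zmult (int k - 2 * int j) a - L (gen n 0)))"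

lemma vpow_zmult_shift: "v * vpow (zmult k a - g) = vpow (zmult (k + 1) a - g)"
  "v' * vpow (zmult k a - g) = vpow (zmult (k - 1) a - g)"
  using zmult_Suc [of k a] zmult_Suc [of "k - 1" a] by (simp_all add: algebra_simps flip: vpow_add)

lemma qcoef_rec: "qcoef 1 = (v + v') * qcoef 0" "qcoef (Suc (Suc k)) = (v + v') * qcoef (Suc k) - qcoef k"
proof -
  show "qcoef 1 = (v + v') * qcoef 0"
    using vpow_zmult_shift [of 0 "L (gen n 0)"] by (simp add: qcoef_def distrib_right)
  have "v * qcoef (Suc k) = (\<Sum>j\<le>Suc k. vpow (zmult (int (Suc (Suc k)) - 2 * int j) a - L (gen n 0)))"
    unfolding qcoef_def sum_distrib_left vpow_zmult_shift by (simp add: algebra_simps)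
  then have 1: "v * qcoef (Suc k) + vpow (zmult (- int (Suc (Suc k))) a - L (gen n 0)) = qcoef (Suc (Suc k))"
    by (simp add: qcoef_def)
  have "v' * qcoef (Suc k) = (\<Sum>j\<le>Suc k. vpow (zmult (int k - 2 * int j) a - L (gen n 0)))"
    unfolding qcoef_def sum_distrib_left vpow_zmult_shift by (simp add: algebra_simps)
  then have 2: "v' * qcoef (Suc k) = qcoef k + vpow (zmult (- int (Suc (Suc k))) a - L (gen n 0))"
    by (simp add: qcoef_def algebra_simps)
  show "qcoef (Suc (Suc k)) = (v + v') * qcoef (Suc k) - qcoef k"
    unfolding distrib_right 2 1 [symmetric] by simp
qed

text \<open>
  The Kazhdan-Lusztig element of \<open>s\<^sub>r \<dots> s\<^sub>1 t u\<close>, for \<open>u\<close> the longest element of \<open>\<langle>s\<^sub>1, \<dots>, s\<^sub>r\<rangle>\<close>,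
  provided that \<open>r a < L(t)\<close>: this inequality makes all exponents of \<open>qcoef r\<close> negative.
\<close>

definition C_top :: "'g hecke" where
  "C_top = wsum Suc (\<tau> 0 (C_sym r)) r + smul (qcoef r) (C_sym r)"

definition top_word :: "nat list" where "top_word = run Suc r @ 0 # longest_word r"

lemma C_top_H: "C_top \<in> H"
  unfolding C_top_def by (intro H_add H_smul wsum_H \<tau>_H C_sym_H) (use r_less n_pos in auto)

lemma C_top_bar: "bar C_top = C_top"
  unfolding C_top_def
proof (rule bar_wsum [where N = r])
  let ?C = "C_sym r"
  have C: "?C \<in> H" by (rule C_sym_H) (use r_less in auto)
  show "\<tau> 0 ?C \<in> H" "?C \<in> H" using C n_pos by auto
  show "eigen (Suc l) ?C" if "l < r" for l by (rule C_sym_eigen) (use that r_less in auto)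
  show "eigen (Suc l) (chain Suc (\<tau> 0 ?C) i)" if "i < l" "l < r" for i l
    using that(1)
  proof (induction i)
    case 0
    have "eigen (Suc l) ?C" by (rule C_sym_eigen) (use that r_less in auto)
    then show ?case unfolding chain.simps using 0 that C r_less by (intro eigen_commute) auto
  next
    case (Suc i)
    have "chain Suc (\<tau> 0 ?C) i \<in> H" by (rule chain_H) (use C Suc that r_less n_pos in auto)
    then show ?case unfolding chain.simps using Suc that r_less by (intro eigen_commute) auto
  qed
  have "\<tau> 0 ?C + smul (qcoef 0) ?C = kl_gen 0 ?C" by (simp add: kl_gen_def qcoef_def)
  moreover have "bar ?C = ?C" using C_sym_bar r_less by simp
  ultimately show "bar (\<tau> 0 ?C + smul (qcoef 0) ?C) = \<tau> 0 ?C + smul (qcoef 0) ?C"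
    using bar_kl_gen [of 0 ?C] C n_pos by simp
qed (use qcoef_rec r_less in auto)

lemma wsum_C_top:
  "dominated (wsum Suc (\<tau> 0 (C_sym r)) r) top_word \<and>
   Poly_Mapping.keys (wsum Suc (\<tau> 0 (C_sym r)) r)
     \<subseteq> cls n ` {run Suc i @ u | i u. i \<le> r \<and> u \<in> (#) 0 ` normal_words r}"
proof -
  let ?C = "C_sym r"
  have C: "?C \<in> H" "dominated ?C (longest_word r)" "Poly_Mapping.keys ?C \<subseteq> cls n ` normal_words r"
    using C_sym_H C_sym_dominated r_less by auto
  have r: "reduced n (run Suc i @ 0 # u)" if "i \<le> r" "u \<in> normal_words r" for i u
    by (rule reduced_normal_words_run_asc) (use that r_less in auto)
  have r0: "reduced n (0 # u)" if "u \<in> normal_words r" for u using r [of 0 u] that by simp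
  show ?thesis unfolding top_word_def
  proof (rule dominated_wsum)
    show "dominated (\<tau> 0 ?C) (0 # longest_word r)"
      by (rule dominated_\<tau> [OF C(1) _ C(3) r0 C(2)]) (use n_pos r0 longest_word_normal_words in auto)
    show "Poly_Mapping.keys (\<tau> 0 ?C) \<subseteq> cls n ` (#) 0 ` normal_words r"
      by (rule keys_\<tau>_reduced [OF C(1) _ C(3) r0]) (use n_pos in auto)
  qed (use C r_less n_pos r longest_word_normal_words in auto)
qed

lemma count_normal_words: "u \<in> normal_words k \<Longrightarrow> count_list u 0 = 0"
  using normal_words_lists [of u k] by (auto simp: count_list_0_iff in_lists_conv_set)

lemma count_run_Suc: "count_list (run Suc j) 0 = 0"
  by (induction j) auto

lemma longest_word_reduced: "reduced n (longest_word r)"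
  by (rule reduced_normal_words [OF longest_word_normal_words]) (use r_less in simp)

lemma top_word_lists: "top_word \<in> lists {..<n}"
proof -
  have "reduced n top_word" unfolding top_word_def by (rule reduced_normal_words_run_asc [OF longest_word_normal_words]) (use r_less in auto)
  then show ?thesis by (rule reduced_lists)
qed

text \<open>
  All words in the support of the weighted sum contain \<open>t\<close> exactly once, and the longest word of
  the symmetric group does not contain it.
\<close>

lemma lookup_wsum_longest_word: "Poly_Mapping.lookup (wsum Suc (\<tau> 0 (C_sym r)) r) (cls n (longest_word r)) = 0"
proof (rule ccontr)
  assume "\<not> ?thesis"
  then have "cls n (longest_word r) \<in> cls n ` {run Suc i @ u | i u. i \<le> r \<and> u \<in> (#) 0 ` normal_words r}"
    using wsum_C_top by (auto simp: in_keys_iff)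
  then obtain i u where u: "i \<le> r" "u \<in> normal_words r" "cls n (longest_word r) = cls n (run Suc i @ 0 # u)"
    by auto
  have "reduced n (run Suc i @ 0 # u)" by (rule reduced_normal_words_run_asc) (use u r_less in auto)
  then have "even (count_list (longest_word r) 0) = even (count_list (run Suc i @ 0 # u) 0)"
    using cls_even_count u longest_word_reduced reduced_lists by blast
  then show False using count_normal_words [OF u(2)] count_normal_words [OF longest_word_normal_words] by (simp add: count_run_Suc)
qed

lemma longest_word_top_word: "cls n (longest_word r) \<noteq> cls n top_word"
proof
  assume "cls n (longest_word r) = cls n top_word"
  then have "even (count_list (longest_word r) 0) = even (count_list top_word 0)"
    using cls_even_count reduced_lists [OF longest_word_reduced] top_word_lists by blast
  then show False using count_normal_words [OF longest_word_normal_words] by (simp add: top_word_def count_run_Suc)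
qed

lemma C_top_lookup_longest_word: "Poly_Mapping.lookup C_top (cls n (longest_word r)) = qcoef r"
  using C_sym_dominated [of r] r_less
  by (simp add: C_top_def lookup_add lookup_wsum_longest_word lookup_smul dominated_def)

lemma zmult_mono: "k \<le> l \<Longrightarrow> zmult k a \<le> zmult l a"
proof (induction l rule: int_ge_induct)
  case (step i)
  then show ?case using zmult_Suc [of i a] a_pos by (simp add: order.trans)
qed simp

lemma C_top_minus_T:
  assumes "zmult (int r) a < L (gen n 0)"
  shows "Poly_Mapping.lookup (C_top - Tw top_word) w \<in> ring_neg"
proof -
  let ?C = "C_sym r"
  have "zmult (int r - 2 * int j) a - L (gen n 0) < 0" for j
    using zmult_mono [of "int r - 2 * int j" "int r"] assms by (simp add: order.strict_trans1)
  then have qcoef: "qcoef r \<in> ring_neg" unfolding qcoef_def by (intro ring_neg_sum) (simp add: ring_neg_vpow)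
  have C: "dominated ?C (longest_word r)" using C_sym_dominated r_less by auto
  then have "qcoef r * Poly_Mapping.lookup ?C w \<in> ring_neg"
    using qcoef by (cases "w = cls n (longest_word r)") (auto simp: dominated_def intro: ring_neg_mult)
  moreover have "Poly_Mapping.lookup (wsum Suc (\<tau> 0 ?C) r) w - Poly_Mapping.lookup (Tw top_word) w \<in> ring_neg"
    using wsum_C_top by (cases "w = cls n top_word") (auto simp: dominated_def lookup_T)
  moreover have "Poly_Mapping.lookup (C_top - Tw top_word) w =
      (Poly_Mapping.lookup (wsum Suc (\<tau> 0 ?C) r) w - Poly_Mapping.lookup (Tw top_word) w)
      + qcoef r * Poly_Mapping.lookup ?C w"
    by (simp add: C_top_def lookup_minus lookup_add lookup_smul)
  ultimately show ?thesis by (simp add: ring_neg_add)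
qed

end

section \<open>Asymptotic parameters and specialization\<close>

lemma L_asym_gen:
  assumes "i < n" shows "L_asym (gen n i) = (if i = 0 then (1, 0) else (0, 1))"
proof -
  have l: "len (gen n i) = 1" using reduced_singleton [OF assms] by (simp add: gen_cls reduced_def)
  define u where "u = (SOME u. u \<in> gen n i \<and> length u = len (gen n i))"
  have "\<exists>u. u \<in> gen n i \<and> length u = len (gen n i)"
    using mem_cls_self [of "[i]" n] assms l by (auto simp: gen_cls)
  then have u: "u \<in> gen n i" "length u = 1" unfolding u_def l by (rule someI2_ex, simp)+
  then obtain j where j: "u = [j]" by (auto simp: length_Suc_conv)
  have "even (count_list [i] 0) = even (count_list u 0)"
    using u(1) cox_rel_even_count [of "[i]" u n] by (simp add: gen_cls mem_cls_iff)
  then have "len_t (gen n i) = (if i = 0 then 1 else 0)"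
    unfolding len_t_def u_def [symmetric] j by (auto split: if_splits)
  then show ?thesis using l by (simp add: L_asym_def)
qed

lemma zmult_01: "zmult k (0, 1 :: int) = (0 :: int, k)"
proof (induction k rule: int_induct [where k = 0])
  case (step1 i)
  then show ?case using zmult_Suc [of i "(0 :: int, 1 :: int)"] by simp
next
  case (step2 i)
  then show ?case using zmult_Suc [of "i - 1" "(0 :: int, 1 :: int)"] by (simp add: prod_eq_iff)
qed (simp add: zero_prod_def)

lemma zmult_minus_1: "zmult (- 1) g = - g"
  using zmult_Suc [of "- 1" g] by (simp add: eq_neg_iff_add_eq_0)

lemma theta_A_sum: "theta_A a b (\<Sum>i\<in>I. f i) = (\<Sum>i\<in>I. theta_A a b (f i))"
  by (induction I rule: infinite_finite_induct) (auto simp: theta_A_add)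

lemma lookup_theta_H: "Poly_Mapping.lookup (theta_H a b x) w = theta_A a b (Poly_Mapping.lookup x w)"
  by (simp add: theta_H_def Poly_Mapping.map.rep_eq when_def)

theorem proposition5p5:
  fixes n :: nat
    and L :: "nat list set \<Rightarrow> 'g::linordered_ab_group_add"
    and a b :: 'g
    and mult :: "(int \<times> int) hecke \<Rightarrow> (int \<times> int) hecke \<Rightarrow> (int \<times> int) hecke"
    and C :: "nat list set \<Rightarrow> (int \<times> int) hecke"
    and mult' :: "'g hecke \<Rightarrow> 'g hecke \<Rightarrow> 'g hecke"
    and C' :: "nat list set \<Rightarrow> 'g hecke"
  assumes "n \<ge> 1"
    and "weight_function n L"
    and "\<forall>s\<in>gens n. L s > 0"
    and "b = L (gen n 0)"
    and "a > 0"
    and "\<forall>i\<in>{1..<n}. L (gen n i) = a"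
    and "hecke_algebra n L_asym mult"
    and "kl_basis n mult C"
    and "hecke_algebra n L mult'"
    and "kl_basis n mult' C'"
    and "b \<le> zmult (int n - 1) a"
  shows "\<exists>w\<in>carrier (W n). theta_H a b (C w) \<noteq> C' w"
proof -
  interpret hecke_type_B n L_asym mult "(0, 1)" "n - 1"
    by standard (use assms(1,7) in \<open>auto simp: L_asym_gen less_prod_def zero_prod_def\<close>)
  let ?z = "cls n top_word" and ?w = "cls n (longest_word (n - 1))"
  have z: "?z \<in> carrier (W n)" using top_word_lists by simp
  have "C ?z = C_top"
  proof (rule kl_basis_unique [OF assms(8) z C_top_H C_top_bar])
    show "Poly_Mapping.lookup (C_top - Tw top_word) y \<in> ring_neg" for y
      by (rule C_top_minus_T) (use assms(1) in \<open>simp add: zmult_01 L_asym_gen\<close>)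
  qed
  then have "Poly_Mapping.lookup (theta_H a b (C ?z)) ?w = theta_A a b (qcoef (n - 1))"
    using C_top_lookup_longest_word by (simp add: lookup_theta_H)
  also have "\<dots> = (\<Sum>j\<le>n - 1. vpow (zmult (int (n - 1) - 2 * int j) a - b))"
    using assms(1) by (simp add: qcoef_def theta_A_sum L_asym_gen zmult_01 theta_A_vpow zmult_minus_1)
  finally have eq: "Poly_Mapping.lookup (theta_H a b (C ?z)) ?w = \<dots>" .
  \<comment> \<open>The exponent of the image of \<open>V\<^bsup>-1\<^esup> v\<^bsup>n-1\<^esup>\<close>.\<close>
  let ?g = "zmult (int (n - 1)) a - b"
  have "0 < Poly_Mapping.lookup (\<Sum>j\<le>n - 1. vpow (zmult (int (n - 1) - 2 * int j) a - b)) ?g"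
    unfolding lookup_sum by (rule sum_pos2 [of _ 0]) (auto simp: lookup_vpow)
  then have "?g \<in> Poly_Mapping.keys (Poly_Mapping.lookup (theta_H a b (C ?z)) ?w)"
    unfolding eq in_keys_iff by simp
  moreover have "\<not> ?g < 0" using assms(1,11) by (simp add: of_nat_diff)
  ultimately have "Poly_Mapping.lookup (theta_H a b (C ?z)) ?w \<notin> ring_neg"
    unfolding ring_neg_def by blast
  moreover have "Poly_Mapping.lookup (C' ?z) ?w \<in> ring_neg"
  proof -
    have "Poly_Mapping.lookup (C' ?z - T ?z) ?w \<in> ring_neg" using assms(10) z by (auto simp: kl_basis_def)
    then show ?thesis using longest_word_top_word by (simp add: lookup_minus lookup_T)
  qed
  ultimately show ?thesis using z by metis
qed

end
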